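(* There is a rational function $f$ with poles off $\overline{\mathbb{D}}$ and values in $\mathbb{C}^2$ such that: $f$ restricts to a proper analytic map of $\mathbb{D}$ into $\mathbb{B}_2$; $f|_{\mathbb{D}}$ is injective; $f$ extends to a differentiable map on $\mathbb{D}\cup\{\pm1\}$; $f(1)=f(-1)$; $f$ meets $\partial\mathbb{B}_2$ transversally; $f$ is one-to-one on $\overline{\mathbb{D}}$ except for the fact that $f(-1)=f(1)$; and $f$ is a biholomorphism of $\mathbb{D}$ onto $V=f(\mathbb{D})$. Moreover $V=f(\mathbb{D})$ is a variety and $\mathcal{M}_V\subsetneqq H^\infty(V)$. In particular, $f^{-1}:V\to\mathbb{D}$ is not a multiplier, i.e. $f^{-1}\notin\mathcal{M}_V$.
   Context: $\mathbb{B}_d$ is the open unit ball of $\mathbb{C}^d$. The Drury-Arveson space $\mathcal{H}_d$ is the reproducing kernel Hilbert space on $\mathbb{B}_d$ with kernel $k(x,y)=\frac{1}{1-\langle x,y\rangle}$, $k_y(x)=k(x,y)$, and $\mathcal{M}_d$ is its multiplier algebra. A variety in $\mathbb{B}_d$ is a set of the form $\bigcap_{i} \{x\in\mathbb{B}_d: h_i(x)=0\}$ for a family $\{h_i\}\subset\mathcal{M}_d$. For a variety $V$, $\mathcal{H}_V=\overline{\operatorname{span}}\{k_y:y\in V\}$, considered as a Hilbert space of functions on $V$, and $\mathcal{M}_V$ is its multiplier algebra (an algebra of functions on $V$). A function on $V$ is holomorphic if near each point of $V$ it is the restriction of a holomorphic function on a ball about that point; $H^\infty(V)$ is the space of bounded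 holomorphic functions on $V$. A biholomorphism is a bijection that is holomorphic with holomorphic inverse. A map $f:\mathbb{D}\to\mathbb{B}_d$ is proper if $\lim_{|z|\to1}\|f(z)\|=1$; it meets $\partial\mathbb{B}_d$ transversally if $\langle f(z),f'(z)\rangle\neq0$ for all $z\in\partial\mathbb{D}$. *)

theory Defs
  imports "HOL-Complex_Analysis.Complex_Analysis"
begin

unbundle no fps_syntax

text \<open>
  A function on a set \<open>X\<close> is represented by a total function that is \<open>0\<close> outside \<open>X\<close>, so that
  equality of functions on \<open>X\<close> is HOL equality.
\<close>

definition res :: "'a set \<Rightarrow> ('a \<Rightarrow> complex) \<Rightarrow> 'a \<Rightarrow> complex" where
  "res X h = (\<lambda>x. if x \<in> X then h x else 0)"

definition ip_norm :: "(('a \<Rightarrow> complex) \<Rightarrow> ('a \<Rightarrow> complex) \<Rightarrow> complex) \<Rightarrow> ('a \<Rightarrow> complex) \<Rightarrow> real" where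
  "ip_norm ip h = sqrt (Re (ip h h))"

text \<open>
  \<open>H\<close> with inner product \<open>ip\<close> (linear in the first argument) is a Hilbert space of functions on
  \<open>X\<close> with reproducing kernel \<open>K\<close>.  The values of \<open>ip\<close> outside \<open>H\<close> are irrelevant.
\<close>

locale rkhs =
  fixes X :: "'a set"
    and K :: "'a \<Rightarrow> 'a \<Rightarrow> complex"
    and H :: "('a \<Rightarrow> complex) set"
    and ip :: "('a \<Rightarrow> complex) \<Rightarrow> ('a \<Rightarrow> complex) \<Rightarrow> complex"
  assumes zero_outside: "\<lbrakk>h \<in> H; x \<notin> X\<rbrakk> \<Longrightarrow> h x = 0"
    and zero_mem: "(\<lambda>x. 0) \<in> H"
    and add_mem: "\<lbrakk>g \<in> H; h \<in> H\<rbrakk> \<Longrightarrow> (\<lambda>x. g x + h x) \<in> H"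
    and scale_mem: "h \<in> H \<Longrightarrow> (\<lambda>x. c * h x) \<in> H"
    and ip_add_left: "\<lbrakk>f \<in> H; g \<in> H; h \<in> H\<rbrakk> \<Longrightarrow> ip (\<lambda>x. f x + g x) h = ip f h + ip g h"
    and ip_scale_left: "\<lbrakk>g \<in> H; h \<in> H\<rbrakk> \<Longrightarrow> ip (\<lambda>x. c * g x) h = c * ip g h"
    and ip_cnj: "\<lbrakk>g \<in> H; h \<in> H\<rbrakk> \<Longrightarrow> ip g h = cnj (ip h g)"
    and ip_pos: "\<lbrakk>h \<in> H; h \<noteq> (\<lambda>x. 0)\<rbrakk> \<Longrightarrow> 0 < Re (ip h h)"
    and complete:
      "\<lbrakk>\<And>n::nat. s n \<in> H;
        \<And>e. 0 < e \<Longrightarrow> \<exists>N. \<forall>m\<ge>N. \<forall>n\<ge>N. ip_norm ip (\<lambda>x. s m x - s n x) < e\<rbrakk>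
       \<Longrightarrow> \<exists>h\<in>H. (\<lambda>n. ip_norm ip (\<lambda>x. s n x - h x)) \<longlonglongrightarrow> 0"
    and kernel_mem: "y \<in> X \<Longrightarrow> res X (\<lambda>x. K x y) \<in> H"
    and reproducing: "\<lbrakk>h \<in> H; y \<in> X\<rbrakk> \<Longrightarrow> ip h (res X (\<lambda>x. K x y)) = h y"

text \<open>Boundedness of multiplication on a Hilbert space \<open>H\<close> is automatic by the closed graph theorem.\<close>

definition multipliers :: "'a set \<Rightarrow> ('a \<Rightarrow> complex) set \<Rightarrow> ('a \<Rightarrow> complex) set" where
  "multipliers X H = {\<phi>. (\<forall>x. x \<notin> X \<longrightarrow> \<phi> x = 0) \<and> (\<forall>h\<in>H. (\<lambda>x. \<phi> x * h x) \<in> H)}"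


definition herm :: "complex ^ 'n \<Rightarrow> complex ^ 'n \<Rightarrow> complex" where
  "herm x y = (\<Sum>i\<in>UNIV. x $ i * cnj (y $ i))"

abbreviation unit_ball :: "(complex ^ 'n) set" where
  "unit_ball \<equiv> ball 0 1"

abbreviation unit_disc :: "complex set" where
  "unit_disc \<equiv> ball 0 1"

definition da_kernel :: "complex ^ 'n \<Rightarrow> complex ^ 'n \<Rightarrow> complex" where
  "da_kernel x y = 1 / (1 - herm x y)"

text \<open>
  The Drury-Arveson space together with its inner product.  It is unique up to the irrelevant
  values of the inner product outside the space.
\<close>

definition drury_arveson ::
    "(complex ^ 'n \<Rightarrow> complex) set \<times> ((complex ^ 'n \<Rightarrow> complex) \<Rightarrow> (complex ^ 'n \<Rightarrow> complex) \<Rightarrow> complex)" where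
  "drury_arveson = (SOME p. rkhs unit_ball da_kernel (fst p) (snd p))"

definition da_space :: "(complex ^ 'n \<Rightarrow> complex) set" where
  "da_space = fst drury_arveson"

definition da_norm :: "(complex ^ 'n \<Rightarrow> complex) \<Rightarrow> real" where
  "da_norm = ip_norm (snd drury_arveson)"

definition da_multipliers :: "(complex ^ 'n \<Rightarrow> complex) set" where
  "da_multipliers = multipliers unit_ball da_space"

definition variety :: "(complex ^ 'n) set \<Rightarrow> bool" where
  "variety V \<longleftrightarrow> (\<exists>S \<subseteq> da_multipliers. V = {x \<in> unit_ball. \<forall>h\<in>S. h x = 0})"

definition kernel_span :: "(complex ^ 'n) set \<Rightarrow> (complex ^ 'n \<Rightarrow> complex) set" where
  "kernel_span V =
     {\<lambda>x. \<Sum>y\<in>F. c y * res unit_ball (\<lambda>x. da_kernel x y) x | F c. finite F \<and> F \<subseteq> V}"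

definition kernel_closed_span :: "(complex ^ 'n) set \<Rightarrow> (complex ^ 'n \<Rightarrow> complex) set" where
  "kernel_closed_span V =
     {h \<in> da_space. \<forall>e>0. \<exists>g\<in>kernel_span V. da_norm (\<lambda>x. h x - g x) < e}"

definition variety_space :: "(complex ^ 'n) set \<Rightarrow> (complex ^ 'n \<Rightarrow> complex) set" where
  "variety_space V = res V ` kernel_closed_span V"

definition variety_multipliers :: "(complex ^ 'n) set \<Rightarrow> (complex ^ 'n \<Rightarrow> complex) set" where
  "variety_multipliers V = multipliers V (variety_space V)"


text \<open>For open \<open>S\<close>: real differentiable with complex-linear derivative.\<close>

definition holomorphic_multi_on :: "(complex ^ 'n \<Rightarrow> complex) \<Rightarrow> (complex ^ 'n) set \<Rightarrow> bool" where
  "holomorphic_multi_on G S \<longleftrightarrow>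
     (\<forall>x\<in>S. \<exists>L. (G has_derivative L) (at x) \<and> (\<forall>c v. L (c *s v) = c * L v))"

definition holomorphic_on_variety :: "(complex ^ 'n \<Rightarrow> complex) \<Rightarrow> (complex ^ 'n) set \<Rightarrow> bool" where
  "holomorphic_on_variety g V \<longleftrightarrow>
     (\<forall>p\<in>V. \<exists>r>0. \<exists>G. holomorphic_multi_on G (ball p r) \<and> (\<forall>x\<in>V \<inter> ball p r. g x = G x))"

definition H_infinity :: "(complex ^ 'n) set \<Rightarrow> (complex ^ 'n \<Rightarrow> complex) set" where
  "H_infinity V =
     {g. (\<forall>x. x \<notin> V \<longrightarrow> g x = 0) \<and> holomorphic_on_variety g V \<and> bounded (g ` V)}"

definition analytic_disc_map :: "(complex \<Rightarrow> complex ^ 'n) \<Rightarrow> bool" where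
  "analytic_disc_map f \<longleftrightarrow> (\<forall>i. (\<lambda>z. f z $ i) holomorphic_on unit_disc)"

definition proper_disc_map :: "(complex \<Rightarrow> complex ^ 'n) \<Rightarrow> bool" where
  "proper_disc_map f \<longleftrightarrow>
     f ` unit_disc \<subseteq> unit_ball \<and>
     ((\<lambda>z. norm (f z)) \<longlongrightarrow> 1) (filtercomap cmod (at_left 1))"

definition disc_biholomorphism :: "(complex \<Rightarrow> complex ^ 'n) \<Rightarrow> (complex ^ 'n) set \<Rightarrow> bool" where
  "disc_biholomorphism f V \<longleftrightarrow>
     bij_betw f unit_disc V \<and> analytic_disc_map f \<and>
     holomorphic_on_variety (inv_into unit_disc f) V"

text \<open>At a zero of a denominator the value is irrelevant (it is \<open>0\<close>, by \<open>x / 0 = 0\<close>).\<close>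

definition rational_poles_off :: "(complex \<Rightarrow> complex ^ 'n) \<Rightarrow> complex set \<Rightarrow> bool" where
  "rational_poles_off f A \<longleftrightarrow>
     (\<exists>p q :: 'n \<Rightarrow> complex poly. \<forall>i.
        q i \<noteq> 0 \<and> (\<forall>z\<in>A. poly (q i) z \<noteq> 0) \<and> (\<forall>z. f z $ i = poly (p i) z / poly (q i) z))"

definition cderiv :: "(complex \<Rightarrow> complex ^ 'n) \<Rightarrow> complex \<Rightarrow> complex ^ 'n" where
  "cderiv f z = (\<chi> i. deriv (\<lambda>w. f w $ i) z)"

definition meets_boundary_transversally :: "(complex \<Rightarrow> complex ^ 'n) \<Rightarrow> bool" where
  "meets_boundary_transversally f \<longleftrightarrow> (\<forall>z. cmod z = 1 \<longrightarrow> herm (f z) (cderiv f z) \<noteq> 0)"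

end

theory Submission
  imports Defs "HOL-Real_Asymp.Real_Asymp"
begin

unbundle no fps_syntax

text \<open>
  Let \<open>b z = z (2 z - 1) / (2 - z)\<close>, a Blaschke product, and let \<open>f z = (z\<^sup>2, b z) / \<surd>2\<close>
  (below: \<open>crossing_disc\<close>).  Both \<open>z\<^sup>2\<close> and \<open>b\<close> have modulus one on the circle, so \<open>f\<close> is
  proper into the ball, and it is transversal because \<open>z b'(z) / b(z) > 0\<close> there.  With
  \<open>u = z\<^sup>2\<close> and \<open>v = b z\<close> the equation of \<open>b\<close> reads \<open>z (1 - v) = 2 (u - v)\<close>.  Hence the
  rational function \<open>2 (u - v) / (1 - v)\<close> recovers \<open>z\<close> unless \<open>v = 1\<close>, which happens only at
  \<open>z = 1\<close> and \<open>z = -1\<close>; this gives the injectivity claims and the holomorphic inverse.  It also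
  shows that \<open>V = f(\<D>)\<close> is the zero set in the ball of the polynomial
  \<open>u (1 - v)\<^sup>2 - 4 (u - v)\<^sup>2\<close> (\<open>image_crossing_disc\<close>).

  Polynomials are multipliers.  It suffices to treat a coordinate function, and there the
  kernel \<open>(1 - x\<^sub>i \<cdot> cnj y\<^sub>i) k(x, y) = 1 + (\<Sum>j\<noteq>i. x\<^sub>j \<cdot> cnj y\<^sub>j) k(x, y)\<close> is positive
  (\<open>coordinate_multiplier\<close>).  That positivity of \<open>(1 - \<phi> x \<cdot> cnj (\<phi> y)) K x y\<close> makes \<open>\<phi>\<close> a
  multiplier rests on the Riesz representation theorem, in the form of the membership
  criterion \<open>mem_if_bounded\<close>.  All of this presupposes that the Drury-Arveson space exists,
  which is the Moore-Aronszajn construction (\<open>rkhs_space\<close>).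

  For the multipliers of \<open>V\<close> the tool is the uniform boundedness principle
  (\<open>uniform_boundedness\<close>) on the closed span \<open>M\<close> of the kernel functions at points of \<open>V\<close>.
  A multiplier is bounded: for each \<open>h\<close> in \<open>M\<close> the numbers \<open>\<phi>(y) h(y) / \<parallel>k\<^sub>y\<parallel>\<close> are bounded
  in \<open>y\<close>, whence so are the norms \<open>\<bar>\<phi>(y)\<bar>\<close> of these functionals.  It is holomorphic because
  \<open>k\<^sub>0 = 1\<close> belongs to \<open>M\<close>, so that \<open>\<phi> = \<phi> \<cdot> 1\<close> is a restriction of an element of \<open>M\<close>, and
  elements of \<open>M\<close> composed with \<open>f\<close> are locally uniform limits of holomorphic functions.

  Finally, \<open>f\<^sup>-\<^sup>1\<close> is not a multiplier because the disc meets itself at the boundary.  When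
  \<open>s\<close> tends to \<open>1\<close> and \<open>t\<close> to \<open>-1\<close> along the real axis at suitably matched speeds, the points
  \<open>x = f s\<close> and \<open>y = f t\<close> approach \<open>f 1 = f (-1)\<close> with \<open>\<parallel>k\<^sub>x - k\<^sub>y\<parallel> / \<parallel>k\<^sub>x\<parallel> \<longrightarrow> 0\<close>
  (\<open>kernel_ratio_tendsto\<close>), while \<open>f\<^sup>-\<^sup>1\<close> takes values near \<open>1\<close> and \<open>-1\<close> at them.  If \<open>f\<^sup>-\<^sup>1\<close>
  multiplied, then each \<open>h(x)\<close> would be \<open>O(\<parallel>k\<^sub>x - k\<^sub>y\<parallel>)\<close>, and uniform boundedness would
  give \<open>\<parallel>k\<^sub>x\<parallel> \<le> C \<parallel>k\<^sub>x - k\<^sub>y\<parallel>\<close>, a contradiction.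
\<close>

section \<open>Semidefinite inner products on spaces of functions\<close>

lemma mult_cnj_self: "c * cnj c = (complex_of_real (cmod c))\<^sup>2" "cnj c * c = (complex_of_real (cmod c))\<^sup>2"
  using complex_norm_square[of c] by (simp_all add: mult.commute)

text \<open>
  Definiteness is left out so that the locale covers the finitely supported coefficient
  functions, whose form \<open>\<Sum>x y. c x \<cdot> cnj (d y) \<cdot> K y x\<close> is in general only semidefinite, as well
  as the Hilbert spaces themselves.
\<close>

locale semi_ip =
  fixes S :: "('a \<Rightarrow> complex) set"
    and ip :: "('a \<Rightarrow> complex) \<Rightarrow> ('a \<Rightarrow> complex) \<Rightarrow> complex"
  assumes zero_in: "(\<lambda>x. 0) \<in> S"
    and add_in: "\<lbrakk>g \<in> S; h \<in> S\<rbrakk> \<Longrightarrow> (\<lambda>x. g x + h x) \<in> S"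
    and scale_in: "h \<in> S \<Longrightarrow> (\<lambda>x. c * h x) \<in> S"
    and add_left: "\<lbrakk>f \<in> S; g \<in> S; h \<in> S\<rbrakk> \<Longrightarrow> ip (\<lambda>x. f x + g x) h = ip f h + ip g h"
    and scale_left: "\<lbrakk>g \<in> S; h \<in> S\<rbrakk> \<Longrightarrow> ip (\<lambda>x. c * g x) h = c * ip g h"
    and conj_sym: "\<lbrakk>g \<in> S; h \<in> S\<rbrakk> \<Longrightarrow> ip g h = cnj (ip h g)"
    and ip_nonneg: "h \<in> S \<Longrightarrow> 0 \<le> Re (ip h h)"
begin

abbreviation nrm :: "('a \<Rightarrow> complex) \<Rightarrow> real" where
  "nrm \<equiv> ip_norm ip"

lemma diff_mem: "\<lbrakk>g \<in> S; h \<in> S\<rbrakk> \<Longrightarrow> (\<lambda>x. g x - h x) \<in> S"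
  using add_in[of g "\<lambda>x. (-1) * h x"] scale_in[of h "-1"] by simp

lemma sum_mem: "(\<And>i. i \<in> I \<Longrightarrow> g i \<in> S) \<Longrightarrow> (\<lambda>x. \<Sum>i\<in>I. g i x) \<in> S"
  by (induction I rule: infinite_finite_induct) (auto simp: zero_in intro!: add_in)

lemma ip_diff_left: "\<lbrakk>f \<in> S; g \<in> S; h \<in> S\<rbrakk> \<Longrightarrow> ip (\<lambda>x. f x - g x) h = ip f h - ip g h"
  using add_left[of f "\<lambda>x. (-1) * g x" h] scale_left[of g h "-1"] scale_in[of g "-1"]
  by simp

lemma ip_add_right: "\<lbrakk>f \<in> S; g \<in> S; h \<in> S\<rbrakk> \<Longrightarrow> ip h (\<lambda>x. f x + g x) = ip h f + ip h g"
  using conj_sym[of h "\<lambda>x. f x + g x"] conj_sym[of h f] conj_sym[of h g] add_left[of f g h] add_in[of f g]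
  by simp

lemma ip_scale_right: "\<lbrakk>g \<in> S; h \<in> S\<rbrakk> \<Longrightarrow> ip h (\<lambda>x. c * g x) = cnj c * ip h g"
  using conj_sym[of h "\<lambda>x. c * g x"] conj_sym[of h g] scale_left[of g h c] scale_in[of g c]
  by simp

lemma ip_diff_right: "\<lbrakk>f \<in> S; g \<in> S; h \<in> S\<rbrakk> \<Longrightarrow> ip h (\<lambda>x. f x - g x) = ip h f - ip h g"
  using ip_add_right[of f "\<lambda>x. (-1) * g x" h] ip_scale_right[of g h "-1"] scale_in[of g "-1"]
  by simp

lemma ip_zero_left: "h \<in> S \<Longrightarrow> ip (\<lambda>x. 0) h = 0"
  using scale_left[OF zero_in, of h 0] by simp

lemma ip_zero_right: "h \<in> S \<Longrightarrow> ip h (\<lambda>x. 0) = 0"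
  using ip_scale_right[OF zero_in, of h 0] by simp

lemma ip_sum_right:
  "\<lbrakk>\<And>i. i \<in> I \<Longrightarrow> g i \<in> S; h \<in> S\<rbrakk> \<Longrightarrow> ip h (\<lambda>x. \<Sum>i\<in>I. g i x) = (\<Sum>i\<in>I. ip h (g i))"
proof (induction I rule: infinite_finite_induct)
  case (insert i I)
  then show ?case using ip_add_right[of "g i" "\<lambda>x. \<Sum>i\<in>I. g i x" h] sum_mem[of I g] by simp
qed (auto simp: ip_zero_right)

lemma ip_self: "h \<in> S \<Longrightarrow> ip h h = of_real ((nrm h)\<^sup>2)"
  using conj_sym[of h h] ip_nonneg[of h] by (simp add: ip_norm_def complex_eq_iff)

lemma nrm_nonneg: "h \<in> S \<Longrightarrow> 0 \<le> nrm h"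
  by (simp add: ip_norm_def ip_nonneg)

lemma nrm_scale: "h \<in> S \<Longrightarrow> nrm (\<lambda>x. c * h x) = cmod c * nrm h"
proof -
  assume h: "h \<in> S"
  have "ip (\<lambda>x. c * h x) (\<lambda>x. c * h x) = of_real ((cmod c)\<^sup>2 * (nrm h)\<^sup>2)"
    using h by (simp add: scale_left ip_scale_right scale_in ip_self mult_cnj_self)
  then show ?thesis
    using nrm_nonneg[OF h] by (simp add: ip_norm_def[of ip "\<lambda>x. c * h x"] real_sqrt_mult)
qed

lemma nrm_zero: "nrm (\<lambda>x. 0) = 0"
  by (simp add: ip_norm_def ip_zero_left zero_in)

lemma nrm_sq_add_scale:
  assumes "f \<in> S" "g \<in> S"
  shows "(nrm (\<lambda>x. f x + c * g x))\<^sup>2 = (nrm f)\<^sup>2 + 2 * Re (cnj c * ip f g) + (cmod c)\<^sup>2 * (nrm g)\<^sup>2"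
proof -
  have m: "(\<lambda>x. c * g x) \<in> S" "(\<lambda>x. f x + c * g x) \<in> S"
    using assms add_in scale_in by auto
  have "ip (\<lambda>x. f x + c * g x) (\<lambda>x. f x + c * g x)
      = ip f f + cnj c * ip f g + c * ip g f + c * cnj c * ip g g"
    using assms m add_left[OF assms(1) m(1) m(2)] ip_add_right[OF assms(1) m(1)]
    by (simp add: scale_left ip_scale_right algebra_simps)
  moreover have "c * ip g f = cnj (cnj c * ip f g)"
    using conj_sym[OF assms(2,1)] by simp
  ultimately have "Re (ip (\<lambda>x. f x + c * g x) (\<lambda>x. f x + c * g x))
      = Re (ip f f) + 2 * Re (cnj c * ip f g) + Re (c * cnj c * ip g g)"
    by simp
  also have "c * cnj c * ip g g = of_real ((cmod c)\<^sup>2 * (nrm g)\<^sup>2)"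
    using assms by (simp add: ip_self mult_cnj_self)
  finally show ?thesis
    using m(2) assms ip_self by simp
qed

lemma nrm_sq_diff:
  assumes "f \<in> S" "g \<in> S"
  shows "(nrm (\<lambda>x. f x - g x))\<^sup>2 = (nrm f)\<^sup>2 - 2 * Re (ip f g) + (nrm g)\<^sup>2"
  using nrm_sq_add_scale[OF assms, of "-1"] by simp

lemma nrm_sq_add:
  assumes "f \<in> S" "g \<in> S"
  shows "(nrm (\<lambda>x. f x + g x))\<^sup>2 = (nrm f)\<^sup>2 + 2 * Re (ip f g) + (nrm g)\<^sup>2"
  using nrm_sq_add_scale[OF assms, of 1] by simp

text \<open>
  The standard argument must avoid dividing by \<open>nrm g\<close>, which may vanish for \<open>g \<noteq> 0\<close>: the
  inequality \<open>*\<close> for all real \<open>t\<close> forces \<open>ip f g = 0\<close> in that case.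
\<close>

lemma Cauchy_Schwarz:
  assumes f: "f \<in> S" and g: "g \<in> S"
  shows "cmod (ip f g) \<le> nrm f * nrm g"
proof -
  define a where "a = ip f g"
  have *: "0 \<le> (nrm f)\<^sup>2 - 2 * t * (cmod a)\<^sup>2 + t\<^sup>2 * (cmod a)\<^sup>2 * (nrm g)\<^sup>2" for t :: real
  proof -
    have "cnj (of_real (-t) * a) * ip f g = of_real (- t * (cmod a)\<^sup>2)"
      by (simp add: a_def mult_cnj_self)
    then show ?thesis
      using nrm_sq_add_scale[OF f g, of "of_real (-t) * a"]
      by (metis (no_types, lifting) Re_complex_of_real ab_group_add_class.ab_diff_conv_add_uminus
          mult.assoc mult_minus_left mult_minus_right norm_minus_cancel norm_mult norm_of_real
          of_real_minus power2_abs power_mult_distrib zero_le_power2)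
  qed
  have "(cmod a)\<^sup>2 \<le> (nrm f)\<^sup>2 * (nrm g)\<^sup>2"
  proof (cases "nrm g = 0")
    case True
    have "a = 0"
    proof (rule ccontr)
      assume "a \<noteq> 0"
      then show False
        using *[of "((nrm f)\<^sup>2 + 1) / (2 * (cmod a)\<^sup>2)"] True by (simp add: field_simps)
    qed
    then show ?thesis by simp
  next
    case False
    then have B: "(nrm g)\<^sup>2 > 0" by simp
    have "2 * (1 / B) * y = 2 * (y / B)" "(1 / B)\<^sup>2 * y * B = y / B" if "B > 0" for B y :: real
      using that by (simp_all add: power2_eq_square)
    then have "(cmod a)\<^sup>2 / (nrm g)\<^sup>2 \<le> (nrm f)\<^sup>2"
      using *[of "1 / (nrm g)\<^sup>2"] B by simp
    then show ?thesis
      using B by (simp add: pos_divide_le_eq)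
  qed
  then have "cmod a \<le> sqrt ((nrm f)\<^sup>2 * (nrm g)\<^sup>2)"
    by (rule real_le_rsqrt)
  then show ?thesis
    using nrm_nonneg f g by (simp add: a_def real_sqrt_mult)
qed

lemma nrm_triangle:
  assumes f: "f \<in> S" and g: "g \<in> S"
  shows "nrm (\<lambda>x. f x + g x) \<le> nrm f + nrm g"
proof (rule power2_le_imp_le)
  have "Re (ip f g) \<le> nrm f * nrm g"
    using Cauchy_Schwarz[OF f g] complex_Re_le_cmod[of "ip f g"] by linarith
  then show "(nrm (\<lambda>x. f x + g x))\<^sup>2 \<le> (nrm f + nrm g)\<^sup>2"
    using nrm_sq_add[OF f g] by (simp add: power2_sum)
qed (simp add: nrm_nonneg f g)

lemma nrm_minus_commute:
  assumes "f \<in> S" "g \<in> S"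
  shows "nrm (\<lambda>x. f x - g x) = nrm (\<lambda>x. g x - f x)"
  using nrm_scale[OF diff_mem[OF assms], of "-1"] by simp

lemma nrm_triangle_diff:
  assumes "f \<in> S" "g \<in> S" "h \<in> S"
  shows "nrm (\<lambda>x. f x - h x) \<le> nrm (\<lambda>x. f x - g x) + nrm (\<lambda>x. g x - h x)"
  using nrm_triangle[OF diff_mem[OF assms(1,2)] diff_mem[OF assms(2,3)]] by simp

lemma nrm_diff_ge:
  assumes "f \<in> S" "g \<in> S"
  shows "nrm f \<le> nrm g + nrm (\<lambda>x. f x - g x)"
  using nrm_triangle[OF assms(2) diff_mem[OF assms]] by simp

lemma tendsto_ip_left:
  assumes s: "\<And>n. s n \<in> S" and h: "h \<in> S" and g: "g \<in> S"
    and lim: "(\<lambda>n. nrm (\<lambda>x. s n x - h x)) \<longlonglongrightarrow> 0"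
  shows "(\<lambda>n. ip (s n) g) \<longlonglongrightarrow> ip h g"
proof (rule LIM_zero_cancel, rule Lim_null_comparison)
  show "\<forall>\<^sub>F n in sequentially. norm (ip (s n) g - ip h g) \<le> nrm (\<lambda>x. s n x - h x) * nrm g"
    using Cauchy_Schwarz[OF diff_mem[OF s h] g] ip_diff_left[OF s h g] by simp
  show "(\<lambda>n. nrm (\<lambda>x. s n x - h x) * nrm g) \<longlonglongrightarrow> 0"
    using tendsto_mult_right[OF lim, of "nrm g"] by simp
qed

definition cauchy_seq :: "(nat \<Rightarrow> 'a \<Rightarrow> complex) \<Rightarrow> bool" where
  "cauchy_seq s \<longleftrightarrow> (\<forall>n. s n \<in> S) \<and>
     (\<forall>e>0. \<exists>N. \<forall>m\<ge>N. \<forall>n\<ge>N. nrm (\<lambda>x. s m x - s n x) < e)"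

lemma cauchy_seq_mem: "cauchy_seq s \<Longrightarrow> s n \<in> S"
  by (simp add: cauchy_seq_def)

lemma cauchy_seqD:
  "\<lbrakk>cauchy_seq s; e > 0\<rbrakk> \<Longrightarrow> \<exists>N. \<forall>m\<ge>N. \<forall>n\<ge>N. nrm (\<lambda>x. s m x - s n x) < e"
  by (simp add: cauchy_seq_def)

lemma cauchy_seq_const: "h \<in> S \<Longrightarrow> cauchy_seq (\<lambda>n. h)"
  by (simp add: cauchy_seq_def nrm_zero)

lemma cauchy_seq_scale:
  assumes "cauchy_seq s" shows "cauchy_seq (\<lambda>n x. c * s n x)"
  unfolding cauchy_seq_def
proof (intro conjI allI impI)
  show "(\<lambda>x. c * s n x) \<in> S" for n
    using assms by (simp add: cauchy_seq_mem scale_in)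
  fix e :: real assume e: "e > 0"
  have "e / (cmod c + 1) > 0" using e by (simp add: add_nonneg_pos)
  then obtain N where N: "\<And>m n. m \<ge> N \<Longrightarrow> n \<ge> N \<Longrightarrow> nrm (\<lambda>x. s m x - s n x) < e / (cmod c + 1)"
    using cauchy_seqD[OF assms] by meson
  have "nrm (\<lambda>x. c * s m x - c * s n x) < e" if "m \<ge> N" "n \<ge> N" for m n
  proof -
    have "nrm (\<lambda>x. c * s m x - c * s n x) = cmod c * nrm (\<lambda>x. s m x - s n x)"
      using nrm_scale[OF diff_mem[OF cauchy_seq_mem[OF assms] cauchy_seq_mem[OF assms]], of c m n]
      by (simp add: algebra_simps)
    also have "\<dots> \<le> (cmod c + 1) * nrm (\<lambda>x. s m x - s n x)"
      by (intro mult_right_mono) (auto intro!: nrm_nonneg diff_mem cauchy_seq_mem[OF assms])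
    also have "\<dots> < e"
      using N[OF that] by (simp add: add_nonneg_pos pos_less_divide_eq mult.commute)
    finally show ?thesis .
  qed
  then show "\<exists>N. \<forall>m\<ge>N. \<forall>n\<ge>N. nrm (\<lambda>x. c * s m x - c * s n x) < e" by blast
qed

lemma cauchy_seq_add:
  assumes s: "cauchy_seq s" and t: "cauchy_seq t" shows "cauchy_seq (\<lambda>n x. s n x + t n x)"
  unfolding cauchy_seq_def
proof (intro conjI allI impI)
  show "(\<lambda>x. s n x + t n x) \<in> S" for n
    using assms by (simp add: cauchy_seq_mem add_in)
  fix e :: real assume e: "e > 0"
  then obtain N where N: "\<And>m n. m \<ge> N \<Longrightarrow> n \<ge> N \<Longrightarrow> nrm (\<lambda>x. s m x - s n x) < e / 2"
    using cauchy_seqD[OF s, of "e/2"] by auto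
  obtain N' where N': "\<And>m n. m \<ge> N' \<Longrightarrow> n \<ge> N' \<Longrightarrow> nrm (\<lambda>x. t m x - t n x) < e / 2"
    using cauchy_seqD[OF t, of "e/2"] e by auto
  have "nrm (\<lambda>x. s m x + t m x - (s n x + t n x)) < e" if "m \<ge> max N N'" "n \<ge> max N N'" for m n
    using nrm_triangle[OF diff_mem diff_mem, of "s m" "s n" "t m" "t n"] N[of m n] N'[of m n] that
      cauchy_seq_mem[OF s] cauchy_seq_mem[OF t]
    by (simp add: algebra_simps)
  then show "\<exists>N. \<forall>m\<ge>N. \<forall>n\<ge>N. nrm (\<lambda>x. s m x + t m x - (s n x + t n x)) < e" by blast
qed

lemma cauchy_seq_bounded:
  assumes s: "cauchy_seq s" shows "\<exists>M>0. \<forall>n. nrm (s n) \<le> M"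
proof -
  obtain N where N: "\<And>m n. m \<ge> N \<Longrightarrow> n \<ge> N \<Longrightarrow> nrm (\<lambda>x. s m x - s n x) < 1"
    using cauchy_seqD[OF s, of 1] by auto
  define M where "M = Max (insert 0 ((\<lambda>n. nrm (s n)) ` {..N})) + 1"
  have le: "nrm (s n) \<le> M - 1" if "n \<le> N" for n
    using that Max_ge[of "insert 0 ((\<lambda>n. nrm (s n)) ` {..N})" "nrm (s n)"] unfolding M_def by simp
  have M: "M > 0"
    unfolding M_def using Max_ge[of "insert 0 ((\<lambda>n. nrm (s n)) ` {..N})" 0] by simp
  have "nrm (s n) \<le> M" for n
  proof (cases "n \<le> N")
    case True then show ?thesis using le[of n] by simp
  next
    case False
    then show ?thesis
      using N[of n N] nrm_diff_ge[OF cauchy_seq_mem cauchy_seq_mem, OF s s, of n N] le[of N] by simp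
  qed
  with M show ?thesis by blast
qed

lemma cauchy_seq_ip_convergent:
  assumes s: "cauchy_seq s" and t: "cauchy_seq t"
  shows "convergent (\<lambda>n. ip (s n) (t n))"
proof -
  obtain M where M: "M > 0" "\<And>n. nrm (s n) \<le> M" using cauchy_seq_bounded[OF s] by blast
  obtain M' where M': "M' > 0" "\<And>n. nrm (t n) \<le> M'" using cauchy_seq_bounded[OF t] by blast
  note mem = cauchy_seq_mem[OF s] cauchy_seq_mem[OF t]
  have "Cauchy (\<lambda>n. ip (s n) (t n))"
  proof (rule metric_CauchyI)
    fix e :: real assume e: "e > 0"
    obtain N where N: "\<And>m n. m \<ge> N \<Longrightarrow> n \<ge> N \<Longrightarrow> nrm (\<lambda>x. s m x - s n x) < e / (2 * M')"
      using cauchy_seqD[OF s, of "e / (2 * M')"] e M' by auto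
    obtain N' where N': "\<And>m n. m \<ge> N' \<Longrightarrow> n \<ge> N' \<Longrightarrow> nrm (\<lambda>x. t m x - t n x) < e / (2 * M)"
      using cauchy_seqD[OF t, of "e / (2 * M)"] e M by auto
    have "dist (ip (s m) (t m)) (ip (s n) (t n)) < e" if "m \<ge> max N N'" "n \<ge> max N N'" for m n
    proof -
      have "ip (s m) (t m) - ip (s n) (t n)
          = ip (\<lambda>x. s m x - s n x) (t m) + ip (s n) (\<lambda>x. t m x - t n x)"
        using mem by (simp add: ip_diff_left ip_diff_right)
      then have "cmod (ip (s m) (t m) - ip (s n) (t n))
          \<le> nrm (\<lambda>x. s m x - s n x) * nrm (t m) + nrm (s n) * nrm (\<lambda>x. t m x - t n x)"
        using Cauchy_Schwarz[OF diff_mem[OF mem(1) mem(1)] mem(2), of m n m]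
          Cauchy_Schwarz[OF mem(1) diff_mem[OF mem(2) mem(2)], of n m n]
        by (smt (verit) norm_triangle_ineq)
      also have "nrm (\<lambda>x. s m x - s n x) * nrm (t m) \<le> nrm (\<lambda>x. s m x - s n x) * M'"
        using M' mem by (intro mult_left_mono) (auto intro!: nrm_nonneg diff_mem)
      also have "\<dots> < e / 2" using N[of m n] that M' by (simp add: field_simps)
      also have "nrm (s n) * nrm (\<lambda>x. t m x - t n x) \<le> M * nrm (\<lambda>x. t m x - t n x)"
        using M mem by (intro mult_right_mono) (auto intro!: nrm_nonneg diff_mem)
      also have "\<dots> < e / 2" using N'[of m n] that M by (simp add: field_simps)
      finally show ?thesis by (simp add: dist_norm)
    qed
    then show "\<exists>N. \<forall>m\<ge>N. \<forall>n\<ge>N. dist (ip (s m) (t m)) (ip (s n) (t n)) < e" by blast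
  qed
  then show ?thesis by (simp add: Cauchy_convergent_iff)
qed

end

section \<open>Existence of reproducing kernel Hilbert spaces\<close>

text \<open>
  The indices of \<open>K y x\<close> are in the order in which they arise from
  \<open>\<parallel>\<Sum>x\<in>F. c x \<cdot> k\<^sub>x\<parallel>\<^sup>2\<close> with \<open>\<langle>k\<^sub>x, k\<^sub>y\<rangle> = K y x\<close>.
\<close>

definition psd :: "'a set \<Rightarrow> ('a \<Rightarrow> 'a \<Rightarrow> complex) \<Rightarrow> bool" where
  "psd X K \<longleftrightarrow> (\<forall>F c. finite F \<longrightarrow> F \<subseteq> X \<longrightarrow> 0 \<le> Re (\<Sum>x\<in>F. \<Sum>y\<in>F. c x * cnj (c y) * K y x))"

lemma psdD: "\<lbrakk>psd X K; finite F; F \<subseteq> X\<rbrakk> \<Longrightarrow> 0 \<le> Re (\<Sum>x\<in>F. \<Sum>y\<in>F. c x * cnj (c y) * K y x)"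
  by (simp add: psd_def)

definition finsupp :: "('a \<Rightarrow> complex) \<Rightarrow> 'a set" where
  "finsupp c = {x. c x \<noteq> 0}"

text \<open>
  The Moore-Aronszajn construction.  The pre-Hilbert space consists of the finitely supported
  coefficient functions, where \<open>c\<close> stands for the combination \<open>\<Sum>y. c y \<cdot> K x y\<close>.  Its
  completion is realised directly as a space of functions: the pointwise limits of the
  combinations given by Cauchy sequences of coefficients.
\<close>

locale pd_kernel =
  fixes X :: "'a set" and K :: "'a \<Rightarrow> 'a \<Rightarrow> complex"
  assumes hermitian: "\<lbrakk>x \<in> X; y \<in> X\<rbrakk> \<Longrightarrow> K y x = cnj (K x y)"
    and positive: "psd X K"
begin

definition coeffs :: "('a \<Rightarrow> complex) set" where
  "coeffs = {c. finite (finsupp c) \<and> finsupp c \<subseteq> X}"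

definition comb :: "('a \<Rightarrow> complex) \<Rightarrow> 'a \<Rightarrow> complex" where
  "comb c x = (\<Sum>y\<in>finsupp c. c y * K x y)"

definition form :: "('a \<Rightarrow> complex) \<Rightarrow> ('a \<Rightarrow> complex) \<Rightarrow> complex" where
  "form c d = (\<Sum>x\<in>finsupp d. cnj (d x) * comb c x)"

lemma comb_eq:
  "\<lbrakk>finite F; finsupp c \<subseteq> F\<rbrakk> \<Longrightarrow> comb c x = (\<Sum>y\<in>F. c y * K x y)"
  unfolding comb_def by (rule sum.mono_neutral_left) (auto simp: finsupp_def)

lemma form_eq:
  assumes "finite F" "finsupp c \<subseteq> F" "finsupp d \<subseteq> F"
  shows "form c d = (\<Sum>x\<in>F. \<Sum>y\<in>F. c x * cnj (d y) * K y x)"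
proof -
  have "form c d = (\<Sum>y\<in>F. cnj (d y) * comb c y)"
    unfolding form_def by (rule sum.mono_neutral_left) (use assms in \<open>auto simp: finsupp_def\<close>)
  also have "\<dots> = (\<Sum>y\<in>F. \<Sum>x\<in>F. c x * cnj (d y) * K y x)"
    using comb_eq[OF assms(1,2)] by (simp add: sum_distrib_left mult_ac)
  also have "\<dots> = (\<Sum>x\<in>F. \<Sum>y\<in>F. c x * cnj (d y) * K y x)"
    by (rule sum.swap)
  finally show ?thesis .
qed

lemma coeffs_add: "\<lbrakk>c \<in> coeffs; d \<in> coeffs\<rbrakk> \<Longrightarrow> (\<lambda>x. c x + d x) \<in> coeffs"
proof -
  assume "c \<in> coeffs" "d \<in> coeffs"
  moreover have "finsupp (\<lambda>x. c x + d x) \<subseteq> finsupp c \<union> finsupp d"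
    by (auto simp: finsupp_def)
  ultimately show ?thesis
    using finite_subset[of "finsupp (\<lambda>x. c x + d x)" "finsupp c \<union> finsupp d"] by (auto simp: coeffs_def)
qed

lemma coeffs_scale: "c \<in> coeffs \<Longrightarrow> (\<lambda>x. a * c x) \<in> coeffs"
  unfolding coeffs_def using finite_subset[of "finsupp (\<lambda>x. a * c x)" "finsupp c"]
  by (auto simp: finsupp_def)

lemma comb_add:
  assumes "c \<in> coeffs" "d \<in> coeffs"
  shows "comb (\<lambda>x. c x + d x) z = comb c z + comb d z"
proof -
  define F where "F = finsupp c \<union> finsupp d"
  have "finite F" "finsupp c \<subseteq> F" "finsupp d \<subseteq> F" "finsupp (\<lambda>x. c x + d x) \<subseteq> F"
    using assms by (auto simp: F_def coeffs_def finsupp_def)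
  then show ?thesis
    by (simp add: comb_eq[of F] sum.distrib algebra_simps)
qed

lemma comb_scale: "c \<in> coeffs \<Longrightarrow> comb (\<lambda>x. a * c x) z = a * comb c z"
  by (subst comb_eq[of "finsupp c"]) (auto simp: coeffs_def comb_def finsupp_def sum_distrib_left mult_ac)

lemma comb_diff:
  "\<lbrakk>c \<in> coeffs; d \<in> coeffs\<rbrakk> \<Longrightarrow> comb (\<lambda>x. c x - d x) z = comb c z - comb d z"
  using comb_add[of c "\<lambda>x. -1 * d x" z] comb_scale[of d "-1" z] coeffs_scale[of d "-1"] by simp

sublocale coeffs: semi_ip coeffs form
proof
  show "(\<lambda>x. 0) \<in> coeffs" by (simp add: coeffs_def finsupp_def)
  show "form (\<lambda>x. f x + g x) h = form f h + form g h"
    if "f \<in> coeffs" "g \<in> coeffs" "h \<in> coeffs" for f g h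
    using that by (simp add: form_def comb_add sum.distrib algebra_simps)
  show "form (\<lambda>x. c * g x) h = c * form g h" if "g \<in> coeffs" "h \<in> coeffs" for c g h
    using that by (simp add: form_def comb_scale sum_distrib_left mult_ac)
  show "form g h = cnj (form h g)" if "g \<in> coeffs" "h \<in> coeffs" for g h
  proof -
    define F where "F = finsupp g \<union> finsupp h"
    have F: "finite F" "finsupp g \<subseteq> F" "finsupp h \<subseteq> F" "F \<subseteq> X"
      using that by (auto simp: F_def coeffs_def)
    have "cnj (form h g) = (\<Sum>x\<in>F. \<Sum>y\<in>F. g y * cnj (h x) * cnj (K y x))"
      by (simp add: form_eq[OF F(1,3,2)] mult_ac)
    also have "\<dots> = (\<Sum>x\<in>F. \<Sum>y\<in>F. g y * cnj (h x) * K x y)"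
      using F(4) by (intro sum.cong refl) (metis hermitian subsetD)
    also have "\<dots> = form g h"
      by (subst sum.swap) (simp add: form_eq[OF F(1,2,3)])
    finally show ?thesis by simp
  qed
  show "0 \<le> Re (form h h)" if "h \<in> coeffs" for h
    using psdD[OF positive, of "finsupp h" h] form_eq[of "finsupp h" h h] that by (simp add: coeffs_def)
qed (fact coeffs_add coeffs_scale)+

definition point :: "'a \<Rightarrow> 'a \<Rightarrow> complex" where
  "point y = (\<lambda>x. if x = y then 1 else 0)"

lemma finsupp_point [simp]: "finsupp (point y) = {y}"
  by (simp add: finsupp_def point_def)

lemma point_mem: "y \<in> X \<Longrightarrow> point y \<in> coeffs"
  by (simp add: coeffs_def)

lemma comb_point: "comb (point y) x = K x y"
  by (simp add: comb_def) (simp add: point_def)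

lemma form_point: "form c (point y) = comb c y"
  by (simp add: form_def) (simp add: point_def)

definition represents :: "(nat \<Rightarrow> 'a \<Rightarrow> complex) \<Rightarrow> ('a \<Rightarrow> complex) \<Rightarrow> bool" where
  "represents c h \<longleftrightarrow> coeffs.cauchy_seq c \<and> (\<forall>x\<in>X. (\<lambda>n. comb (c n) x) \<longlonglongrightarrow> h x) \<and> (\<forall>x. x \<notin> X \<longrightarrow> h x = 0)"

definition space :: "('a \<Rightarrow> complex) set" where
  "space = {h. \<exists>c. represents c h}"

definition rep :: "('a \<Rightarrow> complex) \<Rightarrow> nat \<Rightarrow> 'a \<Rightarrow> complex" where
  "rep h = (SOME c. represents c h)"

definition space_ip :: "('a \<Rightarrow> complex) \<Rightarrow> ('a \<Rightarrow> complex) \<Rightarrow> complex" where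
  "space_ip g h = lim (\<lambda>n. form (rep g n) (rep h n))"

lemma represents_rep: "h \<in> space \<Longrightarrow> represents (rep h) h"
  unfolding rep_def using someI_ex[of "\<lambda>c. represents c h"] by (simp add: space_def)

lemma representsD:
  assumes "represents c h"
  shows "coeffs.cauchy_seq c" "\<And>n. c n \<in> coeffs" "\<And>x. x \<in> X \<Longrightarrow> (\<lambda>n. comb (c n) x) \<longlonglongrightarrow> h x"
    "\<And>x. x \<notin> X \<Longrightarrow> h x = 0" "h \<in> space"
  using assms coeffs.cauchy_seq_mem by (auto simp: represents_def space_def)

lemma represents_add: "\<lbrakk>represents c g; represents d h\<rbrakk> \<Longrightarrow> represents (\<lambda>n x. c n x + d n x) (\<lambda>x. g x + h x)"
  unfolding represents_def
  by (auto simp: comb_add coeffs.cauchy_seq_mem intro: coeffs.cauchy_seq_add tendsto_add)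

lemma represents_scale: "represents c h \<Longrightarrow> represents (\<lambda>n x. a * c n x) (\<lambda>x. a * h x)"
  unfolding represents_def
  by (auto simp: comb_scale coeffs.cauchy_seq_mem intro: coeffs.cauchy_seq_scale tendsto_mult_left)

lemma represents_diff: "\<lbrakk>represents c g; represents d h\<rbrakk> \<Longrightarrow> represents (\<lambda>n x. c n x - d n x) (\<lambda>x. g x - h x)"
  using represents_add[of c g "\<lambda>n x. -1 * d n x" "\<lambda>x. -1 * h x"] represents_scale[of d h "-1"] by simp

lemma represents_const: "c \<in> coeffs \<Longrightarrow> represents (\<lambda>n. c) (res X (comb c))"
  unfolding represents_def by (auto simp: coeffs.cauchy_seq_const res_def)

lemma cauchy_null_form_right:
  assumes c: "coeffs.cauchy_seq c" and d: "d \<in> coeffs"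
    and null: "\<And>x. x \<in> X \<Longrightarrow> (\<lambda>n. comb (c n) x) \<longlonglongrightarrow> 0"
  shows "(\<lambda>n. form (c n) d) \<longlonglongrightarrow> 0"
  unfolding form_def using d null by (intro tendsto_null_sum tendsto_mult_right_zero) (auto simp: coeffs_def)

text \<open>
  This is why a function determines its norm.  In
  \<open>form (c n) (c n) = form (c n) (c N) + form (c n) (c n - c N)\<close> the second term is
  uniformly small for large \<open>N\<close> by the Cauchy property; for fixed \<open>N\<close> the first is a finite sum
  of values of \<open>comb (c n)\<close> and tends to zero.
\<close>

lemma cauchy_null_nrm:
  assumes c: "coeffs.cauchy_seq c" 
    and null: "\<And>x. x \<in> X \<Longrightarrow> (\<lambda>n. comb (c n) x) \<longlonglongrightarrow> 0"
  shows "(\<lambda>n. form (c n) (c n)) \<longlonglongrightarrow> 0"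
proof (rule LIMSEQ_I)
  fix e :: real assume e: "e > 0"
  note mem = coeffs.cauchy_seq_mem[OF c]
  obtain M where M: "M > 0" "\<And>n. coeffs.nrm (c n) \<le> M" using coeffs.cauchy_seq_bounded[OF c] by blast
  obtain N where N: "\<And>m n. m \<ge> N \<Longrightarrow> n \<ge> N \<Longrightarrow> coeffs.nrm (\<lambda>x. c m x - c n x) < e / (2 * M)"
    using coeffs.cauchy_seqD[OF c, of "e / (2 * M)"] e M by auto
  obtain N' where N': "\<And>n. n \<ge> N' \<Longrightarrow> cmod (form (c n) (c N)) < e / 2"
    using LIMSEQ_D[OF cauchy_null_form_right[OF c mem[of N] null], of "e/2"] e by auto
  have "norm (form (c n) (c n) - 0) < e" if n: "n \<ge> max N N'" for n
  proof -
    have "form (c n) (c n) = form (c n) (c N) + form (c n) (\<lambda>x. c n x - c N x)"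
      by (simp add: coeffs.ip_diff_right mem)
    moreover have "cmod (form (c n) (\<lambda>x. c n x - c N x)) \<le> coeffs.nrm (c n) * coeffs.nrm (\<lambda>x. c n x - c N x)"
      by (intro coeffs.Cauchy_Schwarz coeffs.diff_mem mem)
    moreover have "\<dots> \<le> M * coeffs.nrm (\<lambda>x. c n x - c N x)"
      by (intro mult_right_mono M coeffs.nrm_nonneg coeffs.diff_mem mem)
    moreover have "\<dots> < e / 2" using N[of n N] n M by (simp add: field_simps)
    moreover have "cmod (form (c n) (c N)) < e / 2" using N' n by simp
    ultimately show ?thesis
      using norm_triangle_ineq[of "form (c n) (c N)" "form (c n) (\<lambda>x. c n x - c N x)"] by simp
  qed
  then show "\<exists>no. \<forall>n\<ge>no. norm (form (c n) (c n) - 0) < e" by blast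
qed

lemma tendsto_form_null:
  assumes c: "represents c (\<lambda>x. 0)" and d: "coeffs.cauchy_seq d"
  shows "(\<lambda>n. form (c n) (d n)) \<longlonglongrightarrow> 0"
proof -
  have "(\<lambda>n. form (c n) (c n)) \<longlonglongrightarrow> 0"
    using cauchy_null_nrm[of c] representsD[OF c] by auto
  then have "(\<lambda>n. sqrt (Re (form (c n) (c n)))) \<longlonglongrightarrow> sqrt (Re 0)"
    by (intro tendsto_intros)
  then have lim: "(\<lambda>n. coeffs.nrm (c n)) \<longlonglongrightarrow> 0"
    by (simp add: ip_norm_def)
  obtain M where M: "M > 0" "\<And>n. coeffs.nrm (d n) \<le> M" using coeffs.cauchy_seq_bounded[OF d] by blast
  have "norm (form (c n) (d n)) \<le> coeffs.nrm (c n) * M" for n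
    using coeffs.Cauchy_Schwarz[of "c n" "d n"] representsD(2)[OF c] coeffs.cauchy_seq_mem[OF d]
      mult_left_mono[OF M(2), of "coeffs.nrm (c n)" n] coeffs.nrm_nonneg[of "c n"]
    by fastforce
  then show ?thesis
    by (intro Lim_null_comparison[OF always_eventually tendsto_mult_left_zero[OF lim]]) auto
qed

text \<open>
  The inner product does not depend on the representing sequences: two of them for the same
  function differ by a sequence that represents \<open>0\<close>, which is null in norm.
\<close>

lemma tendsto_space_ip:
  assumes c: "represents c g" and d: "represents d h"
  shows "(\<lambda>n. form (c n) (d n)) \<longlonglongrightarrow> space_ip g h"
proof -
  define c' where "c' = rep g"
  define d' where "d' = rep h"
  have c': "represents c' g" and d': "represents d' h"
    using represents_rep representsD(5) c d by (auto simp: c'_def d'_def)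
  have "(\<lambda>n. form (c' n) (d' n)) \<longlonglongrightarrow> space_ip g h"
    using coeffs.cauchy_seq_ip_convergent[OF representsD(1)[OF c'] representsD(1)[OF d']]
    by (simp add: space_ip_def c'_def d'_def convergent_LIMSEQ_iff)
  moreover have "(\<lambda>n. form (\<lambda>x. c n x - c' n x) (d n)) \<longlonglongrightarrow> 0"
    using tendsto_form_null[of "\<lambda>n x. c n x - c' n x" d] represents_diff[OF c c'] representsD(1)[OF d] by simp
  moreover have "(\<lambda>n. form (\<lambda>x. d n x - d' n x) (c' n)) \<longlonglongrightarrow> 0"
    using tendsto_form_null[of "\<lambda>n x. d n x - d' n x" c'] represents_diff[OF d d'] representsD(1)[OF c'] by simp
  then have "(\<lambda>n. cnj (form (\<lambda>x. d n x - d' n x) (c' n))) \<longlonglongrightarrow> cnj 0"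
    by (rule tendsto_cnj)
  ultimately have "(\<lambda>n. form (\<lambda>x. c n x - c' n x) (d n) + cnj (form (\<lambda>x. d n x - d' n x) (c' n))
     + form (c' n) (d' n)) \<longlonglongrightarrow> 0 + cnj 0 + space_ip g h"
    by (intro tendsto_add)
  moreover have "form (\<lambda>x. c n x - c' n x) (d n) + cnj (form (\<lambda>x. d n x - d' n x) (c' n))
     + form (c' n) (d' n) = form (c n) (d n)" for n
  proof -
    have "cnj (form (\<lambda>x. d n x - d' n x) (c' n)) = form (c' n) (\<lambda>x. d n x - d' n x)"
      using representsD(2)[OF c'] representsD(2)[OF d'] representsD(2)[OF d] 
      by (metis coeffs.conj_sym coeffs.diff_mem)
    then show ?thesis
      using representsD(2)[OF c'] representsD(2)[OF d'] representsD(2)[OF d] representsD(2)[OF c]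
      by (simp add: coeffs.ip_diff_left coeffs.ip_diff_right)
  qed
  ultimately show ?thesis by simp
qed

lemma space_ip_eqI:
  "\<lbrakk>represents c g; represents d h; (\<lambda>n. form (c n) (d n)) \<longlonglongrightarrow> L\<rbrakk> \<Longrightarrow> space_ip g h = L"
  using tendsto_space_ip LIMSEQ_unique by blast

lemma space_ip_kernel:
  assumes h: "h \<in> space" and y: "y \<in> X"
  shows "space_ip h (res X (\<lambda>x. K x y)) = h y"
proof (rule space_ip_eqI[OF represents_rep[OF h]])
  show "represents (\<lambda>n. point y) (res X (\<lambda>x. K x y))"
    using represents_const[OF point_mem[OF y]] by (simp add: comb_point[abs_def])
  show "(\<lambda>n. form (rep h n) (point y)) \<longlonglongrightarrow> h y"
    using representsD(3)[OF represents_rep[OF h] y] by (simp add: form_point)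
qed

lemma kernel_in_space: "y \<in> X \<Longrightarrow> res X (\<lambda>x. K x y) \<in> space"
  using representsD(5)[OF represents_const[OF point_mem]] by (simp add: comb_point[abs_def])

sublocale space: semi_ip space space_ip
proof
  show "(\<lambda>x. 0) \<in> space"
    using representsD(5)[OF represents_const[OF coeffs.zero_in]]
    by (simp add: res_def comb_def[abs_def] finsupp_def)
  show "(\<lambda>x. g x + h x) \<in> space" if "g \<in> space" "h \<in> space" for g h
    using represents_add[OF represents_rep represents_rep] that representsD(5) by blast
  show "(\<lambda>x. c * h x) \<in> space" if "h \<in> space" for h c
    using represents_scale[OF represents_rep] that representsD(5) by blast
  show "space_ip (\<lambda>x. f x + g x) h = space_ip f h + space_ip g h"
    if "f \<in> space" "g \<in> space" "h \<in> space" for f g h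
  proof (rule space_ip_eqI[OF represents_add represents_rep])
    show "(\<lambda>n. form (\<lambda>x. rep f n x + rep g n x) (rep h n)) \<longlonglongrightarrow> space_ip f h + space_ip g h"
      using tendsto_add[OF tendsto_space_ip tendsto_space_ip, OF represents_rep represents_rep represents_rep represents_rep,
          OF that(1,3,2,3)] representsD(2)[OF represents_rep] that
      by (simp add: coeffs.add_left)
  qed (use that represents_rep in auto)
  show "space_ip (\<lambda>x. c * g x) h = c * space_ip g h" if "g \<in> space" "h \<in> space" for c g h
  proof (rule space_ip_eqI[OF represents_scale represents_rep])
    show "(\<lambda>n. form (\<lambda>x. c * rep g n x) (rep h n)) \<longlonglongrightarrow> c * space_ip g h"
      using tendsto_mult_left[OF tendsto_space_ip, OF represents_rep represents_rep, OF that, of c]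
        representsD(2)[OF represents_rep] that
      by (simp add: coeffs.scale_left)
  qed (use that represents_rep in auto)
  show "space_ip g h = cnj (space_ip h g)" if "g \<in> space" "h \<in> space" for g h
  proof (rule space_ip_eqI[OF represents_rep represents_rep, OF that])
    have "form (rep g n) (rep h n) = cnj (form (rep h n) (rep g n))" for n
      using coeffs.conj_sym representsD(2)[OF represents_rep] that by blast
    then show "(\<lambda>n. form (rep g n) (rep h n)) \<longlonglongrightarrow> cnj (space_ip h g)"
      using tendsto_cnj[OF tendsto_space_ip[OF represents_rep represents_rep, OF that(2,1)]] by simp
  qed
  show "0 \<le> Re (space_ip h h)" if "h \<in> space" for h
    using tendsto_Re[OF tendsto_space_ip[OF represents_rep represents_rep, OF that that]]
      representsD(2)[OF represents_rep[OF that]] coeffs.ip_nonneg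
    by (intro LIMSEQ_le_const) auto
qed

lemma comb_dense:
  assumes h: "h \<in> space" and e: "e > 0"
  shows "\<exists>c\<in>coeffs. space.nrm (\<lambda>x. h x - res X (comb c) x) < e"
proof -
  define c where "c = rep h"
  have c: "represents c h" using represents_rep[OF h] by (simp add: c_def)
  obtain N where N: "\<And>m n. m \<ge> N \<Longrightarrow> n \<ge> N \<Longrightarrow> coeffs.nrm (\<lambda>x. c m x - c n x) < e / 2"
    using coeffs.cauchy_seqD[OF representsD(1)[OF c], of "e/2"] e by auto
  have r: "represents (\<lambda>n x. c n x - c N x) (\<lambda>x. h x - res X (comb (c N)) x)"
    by (intro represents_diff c represents_const representsD(2)[OF c])
  have "(\<lambda>n. Re (form (\<lambda>x. c n x - c N x) (\<lambda>x. c n x - c N x)))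
      \<longlonglongrightarrow> Re (space_ip (\<lambda>x. h x - res X (comb (c N)) x) (\<lambda>x. h x - res X (comb (c N)) x))"
    by (intro tendsto_Re tendsto_space_ip r)
  then have "(\<lambda>n. coeffs.nrm (\<lambda>x. c n x - c N x)) \<longlonglongrightarrow> space.nrm (\<lambda>x. h x - res X (comb (c N)) x)"
    unfolding ip_norm_def by (rule tendsto_real_sqrt)
  moreover have "\<exists>M. \<forall>n\<ge>M. coeffs.nrm (\<lambda>x. c n x - c N x) \<le> e / 2"
    using N less_imp_le by blast
  ultimately have "space.nrm (\<lambda>x. h x - res X (comb (c N)) x) \<le> e / 2"
    by (rule LIMSEQ_le_const2)
  then show ?thesis using representsD(2)[OF c] e by (intro bexI[of _ "c N"]) auto
qed

lemma res_comb_diff: "\<lbrakk>c \<in> coeffs; d \<in> coeffs\<rbrakk> \<Longrightarrow>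
   (\<lambda>x. res X (comb c) x - res X (comb d) x) = res X (comb (\<lambda>x. c x - d x))"
  by (auto simp: res_def comb_diff)

lemma nrm_comb: "c \<in> coeffs \<Longrightarrow> space.nrm (res X (comb c)) = coeffs.nrm c"
  unfolding ip_norm_def
  by (subst space_ip_eqI[OF represents_const represents_const, of c c "form c c"]) auto

lemma space_eval_le:
  assumes "h \<in> space" "y \<in> X"
  shows "cmod (h y) \<le> space.nrm h * space.nrm (res X (\<lambda>x. K x y))"
  using space.Cauchy_Schwarz[OF assms(1) kernel_in_space[OF assms(2)]] space_ip_kernel[OF assms] by simp

text \<open>
  For completeness, a Cauchy sequence of functions is replaced by a sequence of finite
  combinations with the same limit.  Its coefficients form a Cauchy sequence, which represents the
  limit.
\<close>

theorem rkhs_space: "rkhs X K space space_ip"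
proof
  show "h x = 0" if "h \<in> space" "x \<notin> X" for h x
    using representsD(4)[OF represents_rep] that by blast
  show "0 < Re (space_ip h h)" if h: "h \<in> space" "h \<noteq> (\<lambda>x. 0)" for h
  proof (rule ccontr)
    assume "\<not> 0 < Re (space_ip h h)"
    then have n0: "space.nrm h = 0" using space.ip_nonneg[OF h(1)] by (simp add: ip_norm_def)
    have "h x = 0" for x
    proof (cases "x \<in> X")
      case True
      then show ?thesis using space_eval_le[OF h(1), of x] n0 by simp
    qed (use representsD(4)[OF represents_rep[OF h(1)]] in auto)
    with h show False by auto
  qed
  show "\<exists>h\<in>space. (\<lambda>n. ip_norm space_ip (\<lambda>x. s n x - h x)) \<longlonglongrightarrow> 0"
    if s: "\<And>n::nat. s n \<in> space"
      and cau: "\<And>e. 0 < e \<Longrightarrow> \<exists>N. \<forall>m\<ge>N. \<forall>n\<ge>N. ip_norm space_ip (\<lambda>x. s m x - s n x) < e" for s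
  proof -
    have "\<forall>n. \<exists>c\<in>coeffs. space.nrm (\<lambda>x. s n x - res X (comb c) x) < inverse (Suc n)"
      using comb_dense[OF s] by simp
    then obtain d where d: "\<And>n. d n \<in> coeffs"
      and close: "\<And>n. space.nrm (\<lambda>x. s n x - res X (comb (d n)) x) < inverse (Suc n)"
      by metis
    define p where "p = (\<lambda>n. res X (comb (d n)))"
    have p: "p n \<in> space" for n
      unfolding p_def using representsD(5)[OF represents_const[OF d]] .
    have lim_sp: "(\<lambda>n. space.nrm (\<lambda>x. s n x - p n x)) \<longlonglongrightarrow> 0"
      by (rule Lim_null_comparison[OF _ LIMSEQ_inverse_real_of_nat])
        (use close space.nrm_nonneg[OF space.diff_mem[OF s p]] in \<open>simp add: p_def less_imp_le\<close>)
    have cau_s: "space.cauchy_seq s"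
      using s cau by (simp add: space.cauchy_seq_def)
    have "coeffs.cauchy_seq d"
      unfolding coeffs.cauchy_seq_def
    proof (intro conjI allI impI d)
      fix e :: real assume e: "e > 0"
      obtain N where N: "\<And>m n. m \<ge> N \<Longrightarrow> n \<ge> N \<Longrightarrow> space.nrm (\<lambda>x. s m x - s n x) < e / 3"
        using space.cauchy_seqD[OF cau_s, of "e/3"] e by auto
      have "eventually (\<lambda>n. space.nrm (\<lambda>x. s n x - p n x) < e / 3) sequentially"
        using order_tendstoD(2)[OF lim_sp, of "e/3"] e by simp
      then obtain N' where N': "\<And>n. n \<ge> N' \<Longrightarrow> space.nrm (\<lambda>x. s n x - p n x) < e / 3"
        unfolding eventually_sequentially by blast
      have "coeffs.nrm (\<lambda>x. d m x - d n x) < e" if "m \<ge> max N N'" "n \<ge> max N N'" for m n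
      proof -
        have "coeffs.nrm (\<lambda>x. d m x - d n x) = space.nrm (\<lambda>x. p m x - p n x)"
          by (simp add: p_def res_comb_diff d nrm_comb coeffs.diff_mem)
        also have "\<dots> \<le> space.nrm (\<lambda>x. s m x - p m x) + space.nrm (\<lambda>x. s m x - s n x)
            + space.nrm (\<lambda>x. s n x - p n x)"
          using space.nrm_triangle_diff[of "p m" "s m" "p n"] space.nrm_triangle_diff[of "s m" "s n" "p n"]
            space.nrm_minus_commute[of "p m" "s m"] s p by simp
        also have "\<dots> < e" using N[of m n] N'[of m] N'[of n] that by simp
        finally show ?thesis .
      qed
      then show "\<exists>N. \<forall>m\<ge>N. \<forall>n\<ge>N. coeffs.nrm (\<lambda>x. d m x - d n x) < e" by blast
    qed
    note cau_d = this
    define h where "h = res X (\<lambda>x. lim (\<lambda>n. comb (d n) x))"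
    have "represents d h"
      unfolding represents_def
    proof (intro conjI ballI allI impI cau_d)
      fix x assume x: "x \<in> X"
      have "convergent (\<lambda>n. form (d n) (point x))"
        by (intro coeffs.cauchy_seq_ip_convergent cau_d coeffs.cauchy_seq_const point_mem x)
      then show "(\<lambda>n. comb (d n) x) \<longlonglongrightarrow> h x"
        using x by (simp add: form_point h_def res_def convergent_LIMSEQ_iff)
    qed (simp add: h_def res_def)
    note rep_h = this
    have h: "h \<in> space" using representsD(5)[OF rep_h] .
    have lim_ph: "(\<lambda>N. space.nrm (\<lambda>x. h x - p N x)) \<longlonglongrightarrow> 0"
    proof (rule LIMSEQ_I)
      fix e :: real assume e: "e > 0"
      obtain N where N: "\<And>m n. m \<ge> N \<Longrightarrow> n \<ge> N \<Longrightarrow> coeffs.nrm (\<lambda>x. d m x - d n x) < e / 2"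
        using coeffs.cauchy_seqD[OF cau_d, of "e/2"] e by auto
      have "norm (space.nrm (\<lambda>x. h x - p n x) - 0) < e" if n: "n \<ge> N" for n
      proof -
        have r: "represents (\<lambda>k x. d k x - d n x) (\<lambda>x. h x - p n x)"
          unfolding p_def by (intro represents_diff rep_h represents_const d)
        have "(\<lambda>k. coeffs.nrm (\<lambda>x. d k x - d n x)) \<longlonglongrightarrow> space.nrm (\<lambda>x. h x - p n x)"
          unfolding ip_norm_def by (intro tendsto_real_sqrt tendsto_Re tendsto_space_ip r)
        moreover have "\<exists>M. \<forall>k\<ge>M. coeffs.nrm (\<lambda>x. d k x - d n x) \<le> e / 2"
          using N n less_imp_le by blast
        ultimately have "space.nrm (\<lambda>x. h x - p n x) \<le> e / 2"
          by (rule LIMSEQ_le_const2)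
        then show ?thesis using e space.nrm_nonneg[OF space.diff_mem[OF h p]] by simp
      qed
      then show "\<exists>no. \<forall>n\<ge>no. norm (space.nrm (\<lambda>x. h x - p n x) - 0) < e" by blast
    qed
    have "(\<lambda>n. space.nrm (\<lambda>x. s n x - h x)) \<longlonglongrightarrow> 0"
    proof (rule Lim_null_comparison)
      show "\<forall>\<^sub>F n in sequentially. norm (space.nrm (\<lambda>x. s n x - h x))
          \<le> space.nrm (\<lambda>x. s n x - p n x) + space.nrm (\<lambda>x. h x - p n x)"
        using space.nrm_triangle_diff[OF s p h] space.nrm_minus_commute[OF h p]
          space.nrm_nonneg[OF space.diff_mem[OF s h]] by simp
      show "(\<lambda>n. space.nrm (\<lambda>x. s n x - p n x) + space.nrm (\<lambda>x. h x - p n x)) \<longlonglongrightarrow> 0"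
        using tendsto_add[OF lim_sp lim_ph] by simp
    qed
    with h show ?thesis by blast
  qed
qed (auto intro: space.zero_in space.add_in space.scale_in space.add_left space.scale_left
     space.conj_sym kernel_in_space space_ip_kernel)

end

section \<open>Membership and multiplier criteria in a reproducing kernel Hilbert space\<close>

sublocale rkhs \<subseteq> semi_ip H ip
proof
  show "0 \<le> Re (ip h h)" if "h \<in> H" for h
  proof (cases "h = (\<lambda>x. 0)")
    case True
    then show ?thesis using ip_scale_left[of h h 0] that by simp
  qed (use ip_pos[OF that] in simp)
qed (fact zero_mem add_mem scale_mem ip_add_left ip_scale_left ip_cnj)+

context rkhs
begin

abbreviation ker :: "'a \<Rightarrow> 'a \<Rightarrow> complex" where
  "ker y \<equiv> res X (\<lambda>x. K x y)"

lemma ip_ker_ker: "\<lbrakk>x \<in> X; y \<in> X\<rbrakk> \<Longrightarrow> ip (ker x) (ker y) = K y x"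
  using reproducing[OF kernel_mem, of x y] by (simp add: res_def)

lemma nrm_ker_sq: "x \<in> X \<Longrightarrow> (nrm (ker x))\<^sup>2 = Re (K x x)"
  using ip_self[OF kernel_mem, of x] ip_ker_ker[of x x] by (metis Re_complex_of_real)

lemma eval_le: "\<lbrakk>h \<in> H; y \<in> X\<rbrakk> \<Longrightarrow> cmod (h y) \<le> nrm h * nrm (ker y)"
  using Cauchy_Schwarz[OF _ kernel_mem] reproducing by metis

lemma eval_diff_le:
  "\<lbrakk>h \<in> H; x \<in> X; y \<in> X\<rbrakk> \<Longrightarrow> cmod (h x - h y) \<le> nrm h * nrm (\<lambda>z. ker x z - ker y z)"
  using Cauchy_Schwarz[OF _ diff_mem[OF kernel_mem kernel_mem], of h x y]
  by (simp add: ip_diff_right kernel_mem reproducing)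

lemma cauchy_seq_limit:
  assumes "cauchy_seq s"
  obtains h where "h \<in> H" "(\<lambda>n. nrm (\<lambda>x. s n x - h x)) \<longlonglongrightarrow> 0"
  using complete[of s] assms unfolding cauchy_seq_def by blast

definition kcomb :: "'a set \<Rightarrow> ('a \<Rightarrow> complex) \<Rightarrow> 'a \<Rightarrow> complex" where
  "kcomb F c = (\<lambda>x. \<Sum>y\<in>F. c y * ker y x)"

lemma kcomb_mem: "F \<subseteq> X \<Longrightarrow> kcomb F c \<in> H"
  unfolding kcomb_def by (intro sum_mem scale_mem kernel_mem) auto

lemma ip_kcomb: "\<lbrakk>h \<in> H; F \<subseteq> X\<rbrakk> \<Longrightarrow> ip h (kcomb F c) = (\<Sum>y\<in>F. cnj (c y) * h y)"
  unfolding kcomb_def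
  by (subst ip_sum_right) (auto simp: scale_mem kernel_mem ip_scale_right reproducing subset_iff)

lemma kcomb_superset:
  "\<lbrakk>finite G; F \<subseteq> G\<rbrakk> \<Longrightarrow> kcomb F c = kcomb G (\<lambda>y. if y \<in> F then c y else 0)"
  unfolding kcomb_def by (rule ext, rule sum.mono_neutral_cong_left) auto

lemma nrm_kcomb_sq:
  assumes "F \<subseteq> X"
  shows "(nrm (kcomb F c))\<^sup>2 = Re (\<Sum>x\<in>F. \<Sum>y\<in>F. c x * cnj (c y) * K y x)"
proof -
  have "ip (kcomb F c) (kcomb F c) = (\<Sum>y\<in>F. cnj (c y) * kcomb F c y)"
    using ip_kcomb[OF kcomb_mem] assms by blast
  also have "\<dots> = (\<Sum>y\<in>F. \<Sum>x\<in>F. c x * cnj (c y) * K y x)"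
    using assms by (intro sum.cong refl) (auto simp: kcomb_def res_def sum_distrib_left mult_ac intro!: sum.cong)
  also have "\<dots> = (\<Sum>x\<in>F. \<Sum>y\<in>F. c x * cnj (c y) * K y x)"
    by (rule sum.swap)
  finally show ?thesis
    using ip_self[OF kcomb_mem[OF assms], of c] by (metis Re_complex_of_real)
qed

text \<open>
  The Riesz representation theorem for a conjugate-linear functional \<open>l\<close> that is given only on the finite
  combinations of kernel functions, with \<open>l(k\<^sub>y)\<close> prescribed as \<open>g y\<close>.  It is proved by minimising
  \<open>J = \<parallel>v\<parallel>\<^sup>2 - 2 Re (l v)\<close>, which is bounded below because \<open>l\<close> is bounded.  By the
  parallelogram law a minimising sequence is Cauchy.  Its limit \<open>h\<close> lies in the complete space \<open>H\<close>,
  and varying \<open>J\<close> in the direction of \<open>k\<^sub>y\<close> gives \<open>h y = g y\<close>.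
\<close>

lemma mem_if_bounded:
  assumes zero: "\<And>x. x \<notin> X \<Longrightarrow> g x = 0"
    and bd: "\<And>F c. \<lbrakk>finite F; F \<subseteq> X\<rbrakk> \<Longrightarrow> cmod (\<Sum>y\<in>F. cnj (c y) * g y) \<le> C * nrm (kcomb F c)"
  shows "g \<in> H"
proof -
  define I where "I = {(F, c :: 'a \<Rightarrow> complex). finite F \<and> F \<subseteq> X}"
  define v where "v = (\<lambda>(F, c). kcomb F c)"
  define l where "l = (\<lambda>(F, c :: 'a \<Rightarrow> complex). \<Sum>y\<in>F. cnj (c y) * g y)"
  have v: "v i \<in> H" if "i \<in> I" for i using that by (auto simp: I_def v_def kcomb_mem)
  have bd': "cmod (l i) \<le> C * nrm (v i)" if "i \<in> I" for i
    using that bd by (auto simp: I_def v_def l_def)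
  have lin: "\<exists>k\<in>I. v k = (\<lambda>x. a * v i x + b * v j x) \<and> l k = cnj a * l i + cnj b * l j"
    if ij: "i \<in> I" "j \<in> I" for i j a b
  proof -
    obtain F c G d where i: "i = (F, c)" and j: "j = (G, d)" by (metis surj_pair)
    define e where "e = (\<lambda>y. a * (if y \<in> F then c y else 0) + b * (if y \<in> G then d y else 0))"
    have fin: "finite F" "finite G" using ij by (auto simp: I_def i j)
    have "kcomb (F \<union> G) e = (\<lambda>x. a * kcomb F c x + b * kcomb G d x)"
      using kcomb_superset[of "F \<union> G" F c] kcomb_superset[of "F \<union> G" G d] fin
      by (simp add: kcomb_def e_def fun_eq_iff sum_distrib_left sum.distrib algebra_simps)
    moreover have "(\<Sum>y\<in>F \<union> G. cnj (e y) * g y)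
        = cnj a * (\<Sum>y\<in>F \<union> G. (if y \<in> F then cnj (c y) * g y else 0))
        + cnj b * (\<Sum>y\<in>F \<union> G. (if y \<in> G then cnj (d y) * g y else 0))"
      by (auto simp add: e_def sum_distrib_left sum.distrib[symmetric] algebra_simps intro!: sum.cong)
    moreover have "(\<Sum>y\<in>F \<union> G. (if y \<in> F then cnj (c y) * g y else 0)) = (\<Sum>y\<in>F. cnj (c y) * g y)"
      "(\<Sum>y\<in>F \<union> G. (if y \<in> G then cnj (d y) * g y else 0)) = (\<Sum>y\<in>G. cnj (d y) * g y)"
      using fin by (auto intro!: sum.mono_neutral_cong_right)
    ultimately show ?thesis
      using ij by (intro bexI[of _ "(F \<union> G, e)"]) (auto simp: i j v_def l_def I_def)
  qed
  define J where "J = (\<lambda>i. (nrm (v i))\<^sup>2 - 2 * Re (l i))"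
  have J_lower: "- C\<^sup>2 \<le> J i" if "i \<in> I" for i
  proof -
    have "Re (l i) \<le> C * nrm (v i)"
      using bd'[OF that] complex_Re_le_cmod[of "l i"] by linarith
    then show ?thesis
      using zero_le_power2[of "nrm (v i) - C"] by (simp add: J_def power2_diff) (simp add: mult_ac)
  qed
  define m where "m = Inf (J ` I)"
  have I_ne: "({}, \<lambda>x. 0) \<in> I" by (simp add: I_def)
  have bdd: "bdd_below (J ` I)" using J_lower by (auto intro!: bdd_belowI2)
  have m_le: "m \<le> J i" if "i \<in> I" for i
    unfolding m_def using bdd that by (auto intro: cInf_lower)
  have "\<exists>i\<in>I. J i < m + inverse (Suc n)" for n
    using cInf_lessD[of "J ` I" "m + inverse (Suc n)"] I_ne by (auto simp: m_def)
  then obtain s where s: "\<And>n. s n \<in> I" and Js: "\<And>n. J (s n) < m + inverse (Suc n)" by metis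
  note vs = v[OF s]
  \<comment> \<open>the parallelogram law, with the midpoint \<open>v i\<close> admitted to the competition\<close>
  have near: "(nrm (\<lambda>x. v (s j) x - v (s k) x))\<^sup>2 \<le> 2 * inverse (Suc j) + 2 * inverse (Suc k)" for j k
  proof -
    obtain i where i: "i \<in> I" "v i = (\<lambda>x. (1/2) * v (s j) x + (1/2) * v (s k) x)"
      "l i = cnj (1/2) * l (s j) + cnj (1/2) * l (s k)" using lin[OF s s] by blast
    have "v i = (\<lambda>x. (1/2) * (v (s j) x + v (s k) x))"
      using i(2) by (simp add: algebra_simps)
    then have "nrm (v i) = (1/2) * nrm (\<lambda>x. v (s j) x + v (s k) x)"
      using nrm_scale[OF add_mem[OF vs vs], of "1/2" j k] by (simp only: norm_divide) simp
    then have "(nrm (v i))\<^sup>2 = (1/4) * (nrm (\<lambda>x. v (s j) x + v (s k) x))\<^sup>2"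
      by (simp only: power_mult_distrib) (simp add: power2_eq_square)
    moreover have "2 * Re (l i) = Re (l (s j)) + Re (l (s k))"
      by (simp add: i(3))
    ultimately have "(nrm (\<lambda>x. v (s j) x - v (s k) x))\<^sup>2 = 2 * J (s j) + 2 * J (s k) - 4 * J i"
      unfolding J_def nrm_sq_add[OF vs vs] nrm_sq_diff[OF vs vs] by (simp add: algebra_simps)
    also have "\<dots> \<le> 2 * inverse (Suc j) + 2 * inverse (Suc k)"
      using m_le[OF i(1)] Js[of j] Js[of k] by (simp add: algebra_simps)
    finally show ?thesis .
  qed
  have cau: "cauchy_seq (\<lambda>n. v (s n))"
    unfolding cauchy_seq_def
  proof (intro conjI allI impI vs)
    fix e :: real assume e: "e > 0"
    then obtain N where N: "inverse (Suc N) < e\<^sup>2 / 4"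
      using reals_Archimedean[of "e\<^sup>2 / 4"] by auto
    have "nrm (\<lambda>x. v (s j) x - v (s k) x) < e" if "j \<ge> N" "k \<ge> N" for j k
    proof -
      have "inverse (real (Suc j)) \<le> inverse (Suc N)" "inverse (real (Suc k)) \<le> inverse (Suc N)"
        using that by (auto intro!: le_imp_inverse_le)
      then have "(nrm (\<lambda>x. v (s j) x - v (s k) x))\<^sup>2 < e\<^sup>2"
        using near[of j k] N by linarith
      then show ?thesis using e by (intro power2_less_imp_less[of _ e]) auto
    qed
    then show "\<exists>N. \<forall>m\<ge>N. \<forall>n\<ge>N. nrm (\<lambda>x. v (s m) x - v (s n) x) < e" by blast
  qed
  then obtain h where h: "h \<in> H" and lim: "(\<lambda>n. nrm (\<lambda>x. v (s n) x - h x)) \<longlonglongrightarrow> 0"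
    by (rule cauchy_seq_limit)
  have "h y = g y" if y: "y \<in> X" for y
  proof -
    define p where "p = (\<lambda>n. ip (v (s n)) (ker y) - g y)"
    have p_lim: "p \<longlonglongrightarrow> h y - g y"
      unfolding p_def using tendsto_ip_left[OF vs h kernel_mem[OF y] lim] reproducing[OF h y]
      by (auto intro: tendsto_diff)
    have y_I: "({y}, \<lambda>x. 1) \<in> I" using y by (simp add: I_def)
    have var: "0 \<le> inverse (Suc n) + 2 * Re (cnj a * p n) + (cmod a)\<^sup>2 * (nrm (ker y))\<^sup>2" for n a
    proof -
      obtain i where i: "i \<in> I" "v i = (\<lambda>x. 1 * v (s n) x + a * v ({y}, \<lambda>x. 1) x)"
        "l i = cnj 1 * l (s n) + cnj a * l ({y}, \<lambda>x. 1)" using lin[OF s y_I] by blast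
      then have "v i = (\<lambda>x. v (s n) x + a * ker y x)" "l i = l (s n) + cnj a * g y"
        by (auto simp: v_def l_def kcomb_def)
      then have "J i = J (s n) + 2 * Re (cnj a * p n) + (cmod a)\<^sup>2 * (nrm (ker y))\<^sup>2"
        unfolding J_def p_def by (simp add: nrm_sq_add_scale[OF vs kernel_mem[OF y]] algebra_simps)
      then show ?thesis using m_le[OF i(1)] Js[of n] by simp
    qed
    define q where "q = h y - g y"
    have var': "0 \<le> 2 * Re (cnj a * q) + (cmod a)\<^sup>2 * (nrm (ker y))\<^sup>2" for a
    proof -
      have "(\<lambda>n. inverse (Suc n) + 2 * Re (cnj a * p n) + (cmod a)\<^sup>2 * (nrm (ker y))\<^sup>2)
          \<longlonglongrightarrow> 0 + 2 * Re (cnj a * q) + (cmod a)\<^sup>2 * (nrm (ker y))\<^sup>2"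
        unfolding q_def by (intro tendsto_intros LIMSEQ_inverse_real_of_nat p_lim)
      then show ?thesis using var by (intro LIMSEQ_le_const) auto
    qed
    have "q = 0"
    proof (rule ccontr)
      assume "q \<noteq> 0"
      define B where "B = (nrm (ker y))\<^sup>2 + 1"
      have B: "B > 0" by (simp add: B_def add_nonneg_pos)
      \<comment> \<open>adding \<open>1\<close> to the squared norm avoids a case distinction when it vanishes; \<open>a\<close> descends along \<open>q\<close>\<close>
      define a where "a = - of_real (1 / B) * q"
      have "Re (cnj a * q) = - (cmod q)\<^sup>2 / B"
        by (simp add: a_def mult.assoc mult_cnj_self flip: of_real_power)
      moreover have "(cmod a)\<^sup>2 = (cmod q)\<^sup>2 / B\<^sup>2"
        using B by (simp add: a_def norm_mult norm_divide power_divide)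
      ultimately have "0 \<le> - 2 * (cmod q)\<^sup>2 / B + (cmod q)\<^sup>2 / B\<^sup>2 * (B - 1)"
        using var'[of a] by (simp add: B_def)
      also have "\<dots> = - (cmod q)\<^sup>2 * (B + 1) / B\<^sup>2"
        using B by (simp add: field_simps power2_eq_square)
      also have "\<dots> < 0"
        using B \<open>q \<noteq> 0\<close> by (auto intro!: divide_neg_pos mult_neg_pos)
      finally show False by simp
    qed
    then show ?thesis by (simp add: q_def)
  qed
  then have "h = g"
    using zero zero_outside[OF h] by (metis ext)
  with h show ?thesis by simp
qed

text \<open>
  Positivity says that \<open>k\<^sub>y \<mapsto> cnj (\<phi> y) k\<^sub>y\<close> is a contraction on finite combinations; the function
  \<open>\<phi> h\<close> is then the bounded functional obtained from \<open>h\<close> through this map.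
\<close>

lemma multiplierI:
  assumes zero: "\<And>x. x \<notin> X \<Longrightarrow> \<phi> x = 0"
    and pos: "psd X (\<lambda>x y. (1 - \<phi> x * cnj (\<phi> y)) * K x y)"
  shows "\<phi> \<in> multipliers X H"
  unfolding multipliers_def
proof (safe intro!: zero)
  fix h assume h: "h \<in> H"
  show "(\<lambda>x. \<phi> x * h x) \<in> H"
  proof (rule mem_if_bounded[where C = "nrm h"])
    fix F :: "'a set" and c :: "'a \<Rightarrow> complex" assume F: "finite F" "F \<subseteq> X"
    define d where "d = (\<lambda>y. c y * cnj (\<phi> y))"
    have "(\<Sum>y\<in>F. cnj (c y) * (\<phi> y * h y)) = ip h (kcomb F d)"
      using ip_kcomb[OF h F(2), of d] by (simp add: d_def mult_ac)
    then have "cmod (\<Sum>y\<in>F. cnj (c y) * (\<phi> y * h y)) \<le> nrm h * nrm (kcomb F d)"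
      using Cauchy_Schwarz[OF h kcomb_mem[OF F(2)]] by simp
    also have "nrm (kcomb F d) \<le> nrm (kcomb F c)"
    proof (rule power2_le_imp_le[OF _ nrm_nonneg[OF kcomb_mem[OF F(2)]]])
      have "(\<Sum>x\<in>F. \<Sum>y\<in>F. c x * cnj (c y) * ((1 - \<phi> y * cnj (\<phi> x)) * K y x))
         = (\<Sum>x\<in>F. \<Sum>y\<in>F. c x * cnj (c y) * K y x) - (\<Sum>x\<in>F. \<Sum>y\<in>F. d x * cnj (d y) * K y x)"
        by (simp add: d_def algebra_simps sum_subtractf)
      then show "(nrm (kcomb F d))\<^sup>2 \<le> (nrm (kcomb F c))\<^sup>2"
        using psdD[OF pos F, of c] by (simp add: nrm_kcomb_sq[OF F(2)])
    qed
    finally show "cmod (\<Sum>y\<in>F. cnj (c y) * (\<phi> y * h y)) \<le> nrm h * nrm (kcomb F c)"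
      using nrm_nonneg[OF h] by (simp add: mult_left_mono)
  qed (simp add: zero)
qed

lemma multipliers_const: "res X (\<lambda>x. a) \<in> multipliers X H"
proof -
  have "(\<lambda>x. res X (\<lambda>x. a) x * h x) = (\<lambda>x. a * h x)" if "h \<in> H" for h
    using zero_outside[OF that] by (auto simp: res_def fun_eq_iff)
  then show ?thesis by (auto simp: multipliers_def scale_mem) (simp add: res_def)
qed

lemma multipliers_add:
  assumes "res X \<phi> \<in> multipliers X H" "res X \<psi> \<in> multipliers X H"
  shows "res X (\<lambda>x. \<phi> x + \<psi> x) \<in> multipliers X H"
proof -
  have "(\<lambda>x. res X (\<lambda>x. \<phi> x + \<psi> x) x * h x) = (\<lambda>x. res X \<phi> x * h x + res X \<psi> x * h x)" for h
    by (auto simp: res_def algebra_simps fun_eq_iff)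
  then show ?thesis using assms by (auto simp: multipliers_def add_mem) (simp add: res_def)
qed

lemma multipliers_mult:
  assumes "res X \<phi> \<in> multipliers X H" "res X \<psi> \<in> multipliers X H"
  shows "res X (\<lambda>x. \<phi> x * \<psi> x) \<in> multipliers X H"
proof -
  have "(\<lambda>x. res X (\<lambda>x. \<phi> x * \<psi> x) x * h x) = (\<lambda>x. res X \<phi> x * (res X \<psi> x * h x))" for h
    by (auto simp: res_def algebra_simps fun_eq_iff)
  then show ?thesis using assms by (auto simp: multipliers_def) (simp add: res_def)
qed

end

section \<open>Uniform boundedness and multipliers of restrictions\<close>

locale rkhs_subspace = rkhs +
  fixes M :: "('a \<Rightarrow> complex) set"
  assumes M_subset: "M \<subseteq> H"
    and M_zero: "(\<lambda>x. 0) \<in> M"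
    and M_add: "\<lbrakk>g \<in> M; h \<in> M\<rbrakk> \<Longrightarrow> (\<lambda>x. g x + h x) \<in> M"
    and M_scale: "h \<in> M \<Longrightarrow> (\<lambda>x. c * h x) \<in> M"
    and M_closed: "\<lbrakk>\<And>n::nat. s n \<in> M; h \<in> H; (\<lambda>n. nrm (\<lambda>x. s n x - h x)) \<longlonglongrightarrow> 0\<rbrakk> \<Longrightarrow> h \<in> M"
begin

lemma M_mem: "h \<in> M \<Longrightarrow> h \<in> H"
  using M_subset by blast

text \<open>
  One of \<open>h + u\<close>, \<open>h - u\<close> works for the multiple \<open>u\<close> of \<open>g\<close> of norm \<open>r\<close>, because their inner
  products with \<open>g\<close> differ by \<open>2 r \<cdot> nrm g\<close>.
\<close>

lemma exists_step:
  assumes h: "h \<in> M" and g: "g \<in> M" "nrm g > 0" and r: "r > 0"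
  shows "\<exists>h'\<in>M. nrm (\<lambda>x. h' x - h x) = r \<and> r * nrm g \<le> cmod (ip h' g)"
proof -
  define u where "u = (\<lambda>x. of_real (r / nrm g) * g x)"
  have "u \<in> M" unfolding u_def by (intro M_scale g)
  then  have u: "u \<in> M" "nrm u = r" "ip u g = of_real (r * nrm g)"
    using g r nrm_scale[OF M_mem[OF g(1)], of "of_real (r / nrm g)"] ip_self[OF M_mem[OF g(1)]]
      ip_scale_left[OF M_mem[OF g(1)] M_mem[OF g(1)], of "of_real (r / nrm g)"]
    by (auto simp: u_def M_scale power2_eq_square norm_divide)
  have mu: "(\<lambda>x. h x + u x) \<in> M" "(\<lambda>x. h x + -1 * u x) \<in> M"
    using M_add[OF h u(1)] M_add[OF h M_scale[OF u(1), of "-1"]] by auto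
  have "ip (\<lambda>x. h x + u x) g - ip (\<lambda>x. h x + -1 * u x) g = 2 * of_real (r * nrm g)"
    using ip_add_left[OF M_mem[OF h] M_mem[OF u(1)] M_mem[OF g(1)]]
      ip_diff_left[OF M_mem[OF h] M_mem[OF u(1)] M_mem[OF g(1)]] u(3) by simp
  then have "2 * (r * nrm g) = cmod (ip (\<lambda>x. h x + u x) g - ip (\<lambda>x. h x + -1 * u x) g)"
    using r g(2) by (simp add: norm_mult)
  also have "\<dots> \<le> cmod (ip (\<lambda>x. h x + u x) g) + cmod (ip (\<lambda>x. h x + -1 * u x) g)"
    by (rule norm_triangle_ineq4)
  finally have "r * nrm g \<le> cmod (ip (\<lambda>x. h x + u x) g) \<or> r * nrm g \<le> cmod (ip (\<lambda>x. h x + -1 * u x) g)"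
    by linarith
  moreover have "nrm (\<lambda>x. (h x + u x) - h x) = r" "nrm (\<lambda>x. (h x + -1 * u x) - h x) = r"
    using u(2) nrm_scale[OF M_mem[OF u(1)], of "-1"] by simp_all
  ultimately show ?thesis
    using mu bexI[of _ "\<lambda>x. h x + u x" M] bexI[of _ "\<lambda>x. h x + -1 * u x" M] by metis
qed

lemma sum_powers_third: "(\<Sum>k<m. (1/3::real) ^ (n + Suc k)) \<le> (1/3) ^ n / 2"
proof -
  have "(\<Sum>k<m. (1/3::real) ^ (n + Suc k)) = (1/3) ^ n / 2 * (1 - (1/3) ^ m)"
    by (induction m) (simp_all add: algebra_simps power_add)
  also have "\<dots> \<le> (1/3) ^ n / 2"
    by (intro mult_left_le) auto
  finally show ?thesis .
qed

text \<open>
  A gliding hump: if no constant works, choose \<open>i n\<close> with \<open>nrm (g (i n)) > 4\<^sup>n w (i n)\<close> and move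
  by \<open>3\<^sup>-\<^sup>n\<close> in the \<open>n\<close>-th step so that the inner product with \<open>g (i n)\<close> is at least
  \<open>3\<^sup>-\<^sup>n nrm (g (i n))\<close>.  All later steps together have length at most half of \<open>3\<^sup>-\<^sup>n\<close>, so the limit
  retains half of this inner product, which exceeds \<open>(4/3)\<^sup>n w (i n) / 2\<close> for every \<open>n > 0\<close>.
  The weights \<open>w\<close> spare a normalisation of the vectors in the applications.
\<close>

theorem uniform_boundedness:
  assumes g: "\<And>i. i \<in> I \<Longrightarrow> g i \<in> M" and w: "\<And>i. i \<in> I \<Longrightarrow> 0 \<le> w i"
    and bd: "\<And>h. h \<in> M \<Longrightarrow> \<exists>C. \<forall>i\<in>I. cmod (ip h (g i)) \<le> C * w i"
  shows "\<exists>C. \<forall>i\<in>I. nrm (g i) \<le> C * w i"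
proof (rule ccontr)
  assume "\<not> ?thesis"
  then have "\<forall>n::nat. \<exists>i\<in>I. 4 ^ n * w i < nrm (g i)" by (auto simp: not_le)
  then obtain i where i: "\<And>n::nat. i n \<in> I" and big: "\<And>n. 4 ^ n * w (i n) < nrm (g (i n))" by metis
  have pos: "nrm (g (i n)) > 0" for n
    using big[of n] w[OF i[of n]] by (smt (verit) mult_nonneg_nonneg zero_le_power)
  have "\<exists>h. \<forall>n. h n \<in> M \<and> (nrm (\<lambda>x. h (Suc n) x - h n x) = (1/3) ^ (Suc n) \<and>
      (1/3) ^ (Suc n) * nrm (g (i (Suc n))) \<le> cmod (ip (h (Suc n)) (g (i (Suc n)))))"
  proof (rule dependent_nat_choice)
    show "\<exists>h. h \<in> M" using M_zero by blast
    show "\<exists>h'. h' \<in> M \<and> (nrm (\<lambda>x. h' x - h x) = (1/3) ^ (Suc n) \<and>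
      (1/3) ^ (Suc n) * nrm (g (i (Suc n))) \<le> cmod (ip h' (g (i (Suc n)))))" if "h \<in> M" for h n
      using exists_step[OF that g[OF i] pos, of "(1/3) ^ (Suc n)" "Suc n"] by auto
  qed
  then obtain h where h: "\<And>n. h n \<in> M"
    and step: "\<And>n. nrm (\<lambda>x. h (Suc n) x - h n x) = (1/3) ^ (Suc n)"
    and large: "\<And>n. (1/3) ^ (Suc n) * nrm (g (i (Suc n))) \<le> cmod (ip (h (Suc n)) (g (i (Suc n))))"
    by blast
  note hH = M_mem[OF h]
  have near: "nrm (\<lambda>x. h (n + k) x - h n x) \<le> (1/3) ^ n / 2" for n k
  proof -
    have "nrm (\<lambda>x. h (n + k) x - h n x) \<le> (\<Sum>j<k. (1/3) ^ (n + Suc j))"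
    proof (induction k)
      case (Suc k)
      then show ?case
        using nrm_triangle_diff[of "h (n + Suc k)" "h (n + k)" "h n"] hH step[of "n + k"] by simp
    qed (simp add: nrm_zero)
    then show ?thesis using sum_powers_third[of n k] by linarith
  qed
  have "cauchy_seq h"
    unfolding cauchy_seq_def
  proof (intro conjI allI impI hH)
    fix e :: real assume e: "e > 0"
    obtain N where N: "(1/3::real) ^ N < e" using real_arch_pow_inv[OF e, of "1/3"] by auto
    have "nrm (\<lambda>x. h m x - h n x) < e" if "m \<ge> N" "n \<ge> N" for m n
    proof -
      have "nrm (\<lambda>x. h m x - h n x) \<le> nrm (\<lambda>x. h m x - h N x) + nrm (\<lambda>x. h n x - h N x)"
        using nrm_triangle_diff[of "h m" "h N" "h n"] hH nrm_minus_commute[OF hH hH, of N n] by simp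
      also have "\<dots> \<le> (1/3) ^ N"
        using near[of N "m - N"] near[of N "n - N"] that by simp
      finally show ?thesis using N by simp
    qed
    then show "\<exists>N. \<forall>m\<ge>N. \<forall>n\<ge>N. nrm (\<lambda>x. h m x - h n x) < e" by blast
  qed
  then obtain f where f: "f \<in> H" and lim: "(\<lambda>n. nrm (\<lambda>x. h n x - f x)) \<longlonglongrightarrow> 0"
    by (rule cauchy_seq_limit)
  have fM: "f \<in> M" using M_closed[OF h f lim] .
  have f_near: "nrm (\<lambda>x. h n x - f x) \<le> (1/3) ^ n / 2" for n
  proof (rule LIMSEQ_le_const)
    show "(\<lambda>k. (1/3) ^ n / 2 + nrm (\<lambda>x. h (k + n) x - f x)) \<longlonglongrightarrow> (1/3) ^ n / 2"
      using tendsto_add[OF tendsto_const[of "(1/3) ^ n / 2"] LIMSEQ_ignore_initial_segment[OF lim, of n]] by simp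
    have "nrm (\<lambda>x. h n x - f x) \<le> (1/3) ^ n / 2 + nrm (\<lambda>x. h (k + n) x - f x)" for k
      using nrm_triangle_diff[of "h n" "h (k + n)" f] hH f near[of n k] nrm_minus_commute[OF hH hH, of n "k + n"]
      by (simp add: add.commute)
    then show "\<exists>N. \<forall>k\<ge>N. nrm (\<lambda>x. h n x - f x) \<le> (1/3) ^ n / 2 + nrm (\<lambda>x. h (k + n) x - f x)" by blast
  qed
  obtain C where C: "\<And>j. j \<in> I \<Longrightarrow> cmod (ip f (g j)) \<le> C * w j" using bd[OF fM] by blast
  \<comment> \<open>strict, hence contradictory even if \<open>w (i n) = 0\<close>\<close>
  have est: "(4/3) ^ n * w (i n) < 2 * (C * w (i n))" if "n > 0" for n
  proof -
    let ?G = "g (i n)"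
    note G = M_mem[OF g[OF i[of n]]]
    have "(1/3) ^ n * nrm ?G \<le> cmod (ip (h n) ?G)"
      using large[of "n - 1"] that by simp
    also have "ip (h n) ?G = ip f ?G + ip (\<lambda>x. h n x - f x) ?G"
      by (simp add: ip_diff_left hH f G)
    also have "cmod \<dots> \<le> C * w (i n) + (1/3) ^ n / 2 * nrm ?G"
      using C[OF i[of n]] Cauchy_Schwarz[OF diff_mem[OF hH f] G, of n]
        mult_right_mono[OF f_near nrm_nonneg[OF G], of n]
        norm_triangle_ineq[of "ip f ?G" "ip (\<lambda>x. h n x - f x) ?G"] by linarith
    finally have "(1/3) ^ n * nrm ?G \<le> 2 * (C * w (i n))" by simp
    moreover have "(1/3::real) ^ n * (4 ^ n * w (i n)) < (1/3) ^ n * nrm ?G"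
      using big[of n] by simp
    moreover have "(1/3::real) ^ n * (4 ^ n * w (i n)) = (4/3) ^ n * w (i n)"
      by (simp add: power_divide)
    ultimately show ?thesis by simp
  qed
  obtain n where n: "2 * C < (4/3::real) ^ n" using real_arch_pow[of "4/3" "2 * C"] by auto
  have "(4/3::real) ^ n \<le> (4/3) ^ Suc n" by simp
  with n have "2 * C < (4/3::real) ^ Suc n" by linarith
  then have "2 * C * w (i (Suc n)) \<le> (4/3) ^ Suc n * w (i (Suc n))"
    using w[OF i] by (intro mult_right_mono) auto
  with est[of "Suc n"] show False by simp
qed

lemma restricted_multiplierD:
  assumes "\<phi> \<in> multipliers V (res V ` M)" "h \<in> M"
  shows "\<exists>g\<in>M. \<forall>x\<in>V. g x = \<phi> x * h x"
proof -
  have "(\<lambda>x. \<phi> x * res V h x) \<in> res V ` M"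
    using assms by (auto simp: multipliers_def)
  then obtain g where "g \<in> M" "(\<lambda>x. \<phi> x * res V h x) = res V g" by auto
  then show ?thesis by (intro bexI[of _ g]) (auto simp: res_def fun_eq_iff split: if_splits)
qed

text \<open>
  Uniform boundedness for the vectors \<open>cnj (\<phi> y) k\<^sub>y\<close> with weights \<open>\<parallel>k\<^sub>y\<parallel>\<close>: their inner product
  with \<open>h\<close> is the value at \<open>y\<close> of the element of \<open>M\<close> that extends \<open>\<phi> h\<close>.
\<close>

lemma restricted_multiplier_bounded:
  assumes V: "V \<subseteq> X" and ker: "\<And>y. y \<in> V \<Longrightarrow> ker y \<in> M"
    and nz: "\<And>y. y \<in> V \<Longrightarrow> K y y \<noteq> 0"
    and \<phi>: "\<phi> \<in> multipliers V (res V ` M)"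
  shows "bounded (\<phi> ` V)"
proof -
  have pos: "nrm (ker y) > 0" if "y \<in> V" for y
    using ip_self[OF kernel_mem, of y] ip_ker_ker[of y y] nz[OF that] V that nrm_nonneg[OF kernel_mem, of y]
    by (auto simp: less_le)
  have "\<exists>C. \<forall>y\<in>V. nrm (\<lambda>x. cnj (\<phi> y) * ker y x) \<le> C * nrm (ker y)"
  proof (rule uniform_boundedness)
    fix h assume h: "h \<in> M"
    obtain g where g: "g \<in> M" "\<And>x. x \<in> V \<Longrightarrow> g x = \<phi> x * h x" using restricted_multiplierD[OF \<phi> h] by blast
    have "cmod (ip h (\<lambda>x. cnj (\<phi> y) * ker y x)) \<le> nrm g * nrm (ker y)" if y: "y \<in> V" for y
    proof -
      have "ip h (\<lambda>x. cnj (\<phi> y) * ker y x) = g y"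
        using V y by (subst ip_scale_right) (auto simp: M_mem h kernel_mem reproducing g(2))
      then show ?thesis using eval_le[OF M_mem[OF g(1)], of y] V y by auto
    qed
    then show "\<exists>C. \<forall>y\<in>V. cmod (ip h (\<lambda>x. cnj (\<phi> y) * ker y x)) \<le> C * nrm (ker y)" by blast
  qed (use ker V in \<open>auto intro!: M_scale nrm_nonneg kernel_mem\<close>)
  then obtain C where "\<And>y. y \<in> V \<Longrightarrow> nrm (\<lambda>x. cnj (\<phi> y) * ker y x) \<le> C * nrm (ker y)" by blast
  then have "cmod (\<phi> y) \<le> C" if "y \<in> V" for y
    using that pos[OF that] nrm_scale[OF kernel_mem, of y "cnj (\<phi> y)"] V by force
  then show ?thesis by (auto simp: bounded_iff)
qed

text \<open>
  A multiplier that separates the points \<open>x i\<close> and \<open>y i\<close> keeps their kernel functions apart.  With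
  \<open>g = \<phi> h\<close> one has
  \<open>(\<phi>(x) - \<phi>(y)) h(x) = (g(x) - g(y)) - \<phi>(y) (h(x) - h(y))\<close>, and both differences on the right
  are at most a constant times \<open>\<parallel>k\<^sub>x - k\<^sub>y\<parallel>\<close>; uniform boundedness turns this bound on each
  \<open>h(x) = \<langle>h, k\<^sub>x\<rangle>\<close> into one on \<open>\<parallel>k\<^sub>x\<parallel>\<close>.
\<close>

lemma restricted_multiplier_close_points:
  assumes V: "V \<subseteq> X" and \<phi>: "\<phi> \<in> multipliers V (res V ` M)"
    and ker: "\<And>y. y \<in> V \<Longrightarrow> ker y \<in> M"
    and xy: "\<And>i. i \<in> I \<Longrightarrow> x i \<in> V" "\<And>i. i \<in> I \<Longrightarrow> y i \<in> V"
    and sep: "\<And>i. i \<in> I \<Longrightarrow> 1 \<le> cmod (\<phi> (x i) - \<phi> (y i))"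
    and bd: "\<And>i. i \<in> I \<Longrightarrow> cmod (\<phi> (y i)) \<le> 1"
  shows "\<exists>C. \<forall>i\<in>I. nrm (ker (x i)) \<le> C * nrm (\<lambda>z. ker (x i) z - ker (y i) z)"
proof (rule uniform_boundedness)
  fix h assume h: "h \<in> M"
  obtain g where g: "g \<in> M" "\<And>x. x \<in> V \<Longrightarrow> g x = \<phi> x * h x" using restricted_multiplierD[OF \<phi> h] by blast
  have "cmod (ip h (ker (x i))) \<le> (nrm g + nrm h) * nrm (\<lambda>z. ker (x i) z - ker (y i) z)" if i: "i \<in> I" for i
  proof -
    note X = xy(1)[OF i] xy(2)[OF i]
    have XX: "x i \<in> X" "y i \<in> X" using X V by auto
    have eq: "(\<phi> (x i) - \<phi> (y i)) * h (x i) = (g (x i) - g (y i)) - \<phi> (y i) * (h (x i) - h (y i))"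
      using g(2) X by (simp add: algebra_simps)
    have "cmod (ip h (ker (x i))) = cmod (h (x i))"
      using reproducing[OF M_mem[OF h] XX(1)] by simp
    also have "\<dots> \<le> cmod (\<phi> (x i) - \<phi> (y i)) * cmod (h (x i))"
      using mult_right_mono[OF sep[OF i] norm_ge_zero[of "h (x i)"]] by simp
    also have "\<dots> \<le> cmod (g (x i) - g (y i)) + cmod (\<phi> (y i)) * cmod (h (x i) - h (y i))"
      unfolding norm_mult[symmetric] eq by (rule norm_triangle_ineq4)
    also have "\<dots> \<le> cmod (g (x i) - g (y i)) + cmod (h (x i) - h (y i))"
      using mult_right_mono[OF bd[OF i] norm_ge_zero[of "h (x i) - h (y i)"]] by simp
    also have "\<dots> \<le> (nrm g + nrm h) * nrm (\<lambda>z. ker (x i) z - ker (y i) z)"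
      using eval_diff_le[OF M_mem[OF g(1)] XX] eval_diff_le[OF M_mem[OF h] XX] by (simp add: algebra_simps)
    finally show ?thesis .
  qed
  then show "\<exists>C. \<forall>i\<in>I. cmod (ip h (ker (x i))) \<le> C * nrm (\<lambda>z. ker (x i) z - ker (y i) z)" by blast
qed (use ker V xy in \<open>auto intro!: nrm_nonneg diff_mem kernel_mem\<close>)

end

section \<open>The Drury-Arveson space\<close>

lemma psd_cong: "\<lbrakk>psd X K; \<And>x y. \<lbrakk>x \<in> X; y \<in> X\<rbrakk> \<Longrightarrow> L x y = K x y\<rbrakk> \<Longrightarrow> psd X L"
  unfolding psd_def
proof (intro allI impI)
  fix F c
  assume "\<forall>F c. finite F \<longrightarrow> F \<subseteq> X \<longrightarrow> 0 \<le> Re (\<Sum>x\<in>F. \<Sum>y\<in>F. c x * cnj (c y) * K y x)"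
    and F: "finite F" "F \<subseteq> X" and eq: "\<And>x y. \<lbrakk>x \<in> X; y \<in> X\<rbrakk> \<Longrightarrow> L x y = K x y"
  then have "0 \<le> Re (\<Sum>x\<in>F. \<Sum>y\<in>F. c x * cnj (c y) * K y x)" by blast
  also have "(\<Sum>x\<in>F. \<Sum>y\<in>F. c x * cnj (c y) * K y x) = (\<Sum>x\<in>F. \<Sum>y\<in>F. c x * cnj (c y) * L y x)"
    using F eq by (intro sum.cong refl) (auto simp: subset_iff)
  finally show "0 \<le> Re (\<Sum>x\<in>F. \<Sum>y\<in>F. c x * cnj (c y) * L y x)" .
qed

lemma psd_one: "psd X (\<lambda>x y. 1)"
  unfolding psd_def
proof (intro allI impI)
  fix F and c :: "'a \<Rightarrow> complex"
  have "(\<Sum>x\<in>F. \<Sum>y\<in>F. c x * cnj (c y) * 1) = (\<Sum>x\<in>F. c x) * cnj (\<Sum>x\<in>F. c x)"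
    by (simp add: sum_product)
  also have "\<dots> = of_real ((cmod (\<Sum>x\<in>F. c x))\<^sup>2)"
    by (simp only: mult_cnj_self of_real_power)
  finally show "0 \<le> Re (\<Sum>x\<in>F. \<Sum>y\<in>F. c x * cnj (c y) * 1)"
    by (simp only: Re_complex_of_real zero_le_power2)
qed

lemma psd_zero: "psd X (\<lambda>x y. 0)"
  by (simp add: psd_def)

lemma psd_add: "\<lbrakk>psd X K; psd X L\<rbrakk> \<Longrightarrow> psd X (\<lambda>x y. K x y + L x y)"
  by (simp add: psd_def algebra_simps sum.distrib)

lemma psd_sum: "(\<And>i. i \<in> I \<Longrightarrow> psd X (K i)) \<Longrightarrow> psd X (\<lambda>x y. \<Sum>i\<in>I. K i x y)"
  by (induction I rule: infinite_finite_induct) (auto simp: psd_zero intro: psd_add)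

lemma psd_rank_one_mult:
  assumes "psd X K" shows "psd X (\<lambda>x y. a x * cnj (a y) * K x y)"
  unfolding psd_def
proof (intro allI impI)
  fix F and c :: "'a \<Rightarrow> complex"
  assume F: "finite F" "F \<subseteq> X"
  have "0 \<le> Re (\<Sum>x\<in>F. \<Sum>y\<in>F. (c x * cnj (a x)) * cnj (c y * cnj (a y)) * K y x)"
    using psdD[OF assms F, of "\<lambda>x. c x * cnj (a x)"] .
  then show "0 \<le> Re (\<Sum>x\<in>F. \<Sum>y\<in>F. c x * cnj (c y) * (a y * cnj (a x) * K y x))"
    by (simp only: complex_cnj_mult complex_cnj_cnj mult_ac)
qed

lemma psd_herm_mult:
  assumes "psd X K" shows "psd X (\<lambda>x y. herm x y * K x y)"
proof -
  have "psd X (\<lambda>x y. \<Sum>i\<in>UNIV. x $ i * cnj (y $ i) * K x y)"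
    by (intro psd_sum psd_rank_one_mult assms)
  then show ?thesis by (simp add: herm_def sum_distrib_right)
qed

lemma psd_herm_power: "psd X (\<lambda>x y. herm x y ^ n)"
proof (induction n)
  case (Suc n)
  then show ?case using psd_herm_mult by simp
qed (simp add: psd_one)

lemma norm_sq_vec: "(norm (x :: complex ^ 'n))\<^sup>2 = (\<Sum>i\<in>UNIV. (cmod (x $ i))\<^sup>2)"
  by (simp add: norm_vec_def L2_set_def sum_nonneg)

lemma herm_self: "herm x x = of_real ((norm x)\<^sup>2)"
  by (simp add: herm_def norm_sq_vec mult_cnj_self)

lemma herm_cnj: "cnj (herm x y) = herm y x"
  by (simp add: herm_def mult.commute)

lemma norm_herm_le: "cmod (herm x y) \<le> norm x * norm y"
proof -
  have "cmod (herm x y) \<le> (\<Sum>i\<in>UNIV. cmod (x $ i) * cmod (y $ i))"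
    unfolding herm_def by (rule order.trans[OF norm_sum]) (simp add: norm_mult)
  also have "\<dots> \<le> norm x * norm y"
    unfolding norm_vec_def using L2_set_mult_ineq[of "\<lambda>i. cmod (x $ i)" "\<lambda>i. cmod (y $ i)" UNIV] by simp
  finally show ?thesis .
qed

lemma norm_herm_lt_1: "\<lbrakk>x \<in> unit_ball; y \<in> unit_ball\<rbrakk> \<Longrightarrow> cmod (herm x y) < 1"
  using norm_herm_le[of x y] mult_strict_mono'[of "norm x" 1 "norm y" 1] by simp

lemma herm_neq_1: "\<lbrakk>x \<in> unit_ball; y \<in> unit_ball\<rbrakk> \<Longrightarrow> herm x y \<noteq> 1"
  using norm_herm_lt_1[of x y] by auto

text \<open>
  The geometric series \<open>\<Sum>n. herm x y ^ n\<close> consists of positive semidefinite kernels, by induction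
  on \<open>n\<close> through \<open>psd_rank_one_mult\<close>.
\<close>

lemma psd_da_kernel: "psd unit_ball (da_kernel :: complex ^ 'n \<Rightarrow> _)"
  unfolding psd_def
proof (intro allI impI)
  fix F :: "(complex ^ 'n) set" and c assume F: "finite F" "F \<subseteq> unit_ball"
  have lim: "(\<lambda>N. \<Sum>n<N. herm x y ^ n) \<longlonglongrightarrow> da_kernel x y" if "x \<in> F" "y \<in> F" for x y
  proof -
    have "cmod (herm x y) < 1" using F that by (intro norm_herm_lt_1) auto
    then show ?thesis using geometric_sums[of "herm x y"] by (simp add: da_kernel_def sums_def)
  qed
  have "(\<lambda>N. Re (\<Sum>x\<in>F. \<Sum>y\<in>F. c x * cnj (c y) * (\<Sum>n<N. herm y x ^ n)))
      \<longlonglongrightarrow> Re (\<Sum>x\<in>F. \<Sum>y\<in>F. c x * cnj (c y) * da_kernel y x)"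
    by (intro tendsto_intros lim)
  moreover have "psd unit_ball (\<lambda>x y :: complex ^ 'n. \<Sum>n<N. herm x y ^ n)" for N
    by (intro psd_sum psd_herm_power)
  then have "0 \<le> Re (\<Sum>x\<in>F. \<Sum>y\<in>F. c x * cnj (c y) * (\<Sum>n<N. herm y x ^ n))" for N
    using psdD[OF _ F] by blast
  ultimately show "0 \<le> Re (\<Sum>x\<in>F. \<Sum>y\<in>F. c x * cnj (c y) * da_kernel y x)"
    by (intro LIMSEQ_le_const) auto
qed

interpretation da_pd: pd_kernel unit_ball da_kernel
proof
  show "da_kernel y x = cnj (da_kernel x y)" for x y :: "complex ^ 'n"
    using herm_cnj[of x y] by (simp add: da_kernel_def)
qed (fact psd_da_kernel)

abbreviation da_ip :: "(complex ^ 'n \<Rightarrow> complex) \<Rightarrow> (complex ^ 'n \<Rightarrow> complex) \<Rightarrow> complex" where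
  "da_ip \<equiv> snd drury_arveson"

text \<open>
  The Drury-Arveson space is a choice among all spaces with its kernel; every property below is
  derived from the axioms of \<open>rkhs\<close> and so holds for whichever space was chosen.
\<close>

interpretation da: rkhs unit_ball da_kernel da_space da_ip
proof -
  have "\<exists>p. rkhs unit_ball da_kernel (fst p) (snd p :: (complex ^ 'n \<Rightarrow> complex) \<Rightarrow> _)"
    using da_pd.rkhs_space by (metis fst_conv snd_conv)
  then show "rkhs unit_ball da_kernel (da_space :: (complex ^ 'n \<Rightarrow> complex) set) da_ip"
    unfolding da_space_def drury_arveson_def by (rule someI_ex)
qed

text \<open>
  Since \<open>1 - x\<^sub>i \<cdot> cnj y\<^sub>i = (1 - herm x y) + (\<Sum>j\<noteq>i. x\<^sub>j \<cdot> cnj y\<^sub>j)\<close>, multiplying by the kernel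
  leaves the constant kernel \<open>1\<close> plus positive semidefinite kernels.
\<close>

lemma coordinate_multiplier:
  "res unit_ball (\<lambda>x :: complex ^ 'n. x $ i) \<in> da_multipliers"
  unfolding da_multipliers_def
proof (rule da.multiplierI)
  let ?\<phi> = "res unit_ball (\<lambda>x :: complex ^ 'n. x $ i)"
  have "psd unit_ball (\<lambda>x y :: complex ^ 'n. 1 + (\<Sum>j\<in>-{i}. x $ j * cnj (y $ j) * da_kernel x y))"
    by (intro psd_add psd_one psd_sum psd_rank_one_mult psd_da_kernel)
  then show "psd unit_ball (\<lambda>x y. (1 - ?\<phi> x * cnj (?\<phi> y)) * da_kernel x y)"
  proof (rule psd_cong)
    fix x y :: "complex ^ 'n" assume xy: "x \<in> unit_ball" "y \<in> unit_ball"
    have "herm x y = x $ i * cnj (y $ i) + (\<Sum>j\<in>-{i}. x $ j * cnj (y $ j))"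
      unfolding herm_def by (subst sum.remove[of _ i]) (auto simp: Compl_eq_Diff_UNIV)
    then have "1 - x $ i * cnj (y $ i) = (1 - herm x y) + (\<Sum>j\<in>-{i}. x $ j * cnj (y $ j))"
      by simp
    then have "(1 - x $ i * cnj (y $ i)) * da_kernel x y
       = (1 - herm x y) * da_kernel x y + (\<Sum>j\<in>-{i}. x $ j * cnj (y $ j)) * da_kernel x y"
      by (simp only: distrib_right)
    also have "(1 - herm x y) * da_kernel x y = 1"
      using herm_neq_1[OF xy] by (simp add: da_kernel_def)
    finally show "(1 - ?\<phi> x * cnj (?\<phi> y)) * da_kernel x y
       = 1 + (\<Sum>j\<in>-{i}. x $ j * cnj (y $ j) * da_kernel x y)"
      using xy by (simp add: res_def sum_distrib_right)
  qed
qed (simp add: res_def)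

lemmas da_multipliers_const = da.multipliers_const[folded da_multipliers_def]
lemmas da_multipliers_add = da.multipliers_add[folded da_multipliers_def]
lemmas da_multipliers_mult = da.multipliers_mult[folded da_multipliers_def]

section \<open>Closed spans of kernel functions\<close>

lemma kernel_span_mem_iff:
  "V \<subseteq> unit_ball \<Longrightarrow> g \<in> kernel_span V \<longleftrightarrow> (\<exists>F c. finite F \<and> F \<subseteq> V \<and> g = da.kcomb F c)"
  by (auto simp: kernel_span_def da.kcomb_def)

lemma kernel_span_subset: "V \<subseteq> unit_ball \<Longrightarrow> kernel_span V \<subseteq> da_space"
proof
  fix g assume V: "V \<subseteq> unit_ball" and "g \<in> kernel_span V"
  then obtain F c where "F \<subseteq> V" "g = da.kcomb F c" by (auto simp: kernel_span_mem_iff)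
  then show "g \<in> da_space" using V da.kcomb_mem[of F c] by simp
qed

lemma kernel_span_zero: "(\<lambda>x. 0) \<in> kernel_span V"
  unfolding kernel_span_def by (auto intro!: exI[of _ "{}"])

lemma kernel_span_scale: "V \<subseteq> unit_ball \<Longrightarrow> g \<in> kernel_span V \<Longrightarrow> (\<lambda>x. a * g x) \<in> kernel_span V"
proof -
  assume V: "V \<subseteq> unit_ball" and "g \<in> kernel_span V"
  then obtain F c where F: "finite F" "F \<subseteq> V" "g = da.kcomb F c" by (auto simp: kernel_span_mem_iff)
  have "(\<lambda>x. a * g x) = da.kcomb F (\<lambda>y. a * c y)"
    by (simp add: F da.kcomb_def sum_distrib_left mult_ac)
  then show ?thesis unfolding kernel_span_mem_iff[OF V] using F by blast
qed

lemma kernel_span_add: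
  assumes V: "V \<subseteq> unit_ball" and "g \<in> kernel_span V" "h \<in> kernel_span V"
  shows "(\<lambda>x. g x + h x) \<in> kernel_span V"
proof -
  obtain F c where F: "finite F" "F \<subseteq> V" "g = da.kcomb F c" using assms by (auto simp: kernel_span_mem_iff)
  obtain G d where G: "finite G" "G \<subseteq> V" "h = da.kcomb G d" using assms by (auto simp: kernel_span_mem_iff)
  have "(\<lambda>x. g x + h x) = da.kcomb (F \<union> G) (\<lambda>y. (if y \<in> F then c y else 0) + (if y \<in> G then d y else 0))"
    unfolding F(3) G(3) using da.kcomb_superset[of "F \<union> G" F c] da.kcomb_superset[of "F \<union> G" G d] F(1) G(1)
    by (simp add: da.kcomb_def sum.distrib algebra_simps)
  then show ?thesis unfolding kernel_span_mem_iff[OF V] using F G by blast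
qed

lemma kernel_closed_span_iff:
  "h \<in> kernel_closed_span V \<longleftrightarrow> h \<in> da_space \<and> (\<forall>e>0. \<exists>g\<in>kernel_span V. da.nrm (\<lambda>x. h x - g x) < e)"
  by (simp add: kernel_closed_span_def da_norm_def)

lemma kernel_span_le_closed:
  "V \<subseteq> unit_ball \<Longrightarrow> g \<in> kernel_span V \<Longrightarrow> g \<in> kernel_closed_span V"
  using kernel_span_subset[of V] by (auto simp: kernel_closed_span_iff da.nrm_zero intro!: bexI[of _ g])

lemma ker_mem_closed_span:
  assumes "V \<subseteq> unit_ball" "y \<in> V" shows "da.ker y \<in> kernel_closed_span V"
proof -
  have "da.ker y = da.kcomb {y} (\<lambda>_. 1)" by (simp add: da.kcomb_def)
  then show ?thesis using assms by (intro kernel_span_le_closed) (auto simp: kernel_span_mem_iff)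
qed

lemma rkhs_subspace_closed_span:
  assumes V: "V \<subseteq> unit_ball"
  shows "rkhs_subspace unit_ball da_kernel da_space da_ip (kernel_closed_span V)"
proof unfold_locales
  have sp: "g \<in> da_space" if "g \<in> kernel_span V" for g
    using kernel_span_subset[OF V] that by blast
  show sub: "kernel_closed_span V \<subseteq> da_space" by (auto simp: kernel_closed_span_iff)
  show "(\<lambda>x. 0) \<in> kernel_closed_span V" by (intro kernel_span_le_closed V kernel_span_zero)
  show "(\<lambda>x. g x + h x) \<in> kernel_closed_span V"
    if g: "g \<in> kernel_closed_span V" and h: "h \<in> kernel_closed_span V" for g h
    unfolding kernel_closed_span_iff
  proof (intro conjI allI impI)
    show "(\<lambda>x. g x + h x) \<in> da_space" using g h sub by (auto intro: da.add_in)
    fix e :: real assume "e > 0"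
    then obtain p q where p: "p \<in> kernel_span V" "da.nrm (\<lambda>x. g x - p x) < e / 2"
      and q: "q \<in> kernel_span V" "da.nrm (\<lambda>x. h x - q x) < e / 2"
      using g h unfolding kernel_closed_span_iff by (meson half_gt_zero)
    have "da.nrm (\<lambda>x. (g x - p x) + (h x - q x)) < e"
      using da.nrm_triangle[OF da.diff_mem da.diff_mem, of g p h q] p q sp sub g h by fastforce
    then show "\<exists>r\<in>kernel_span V. da.nrm (\<lambda>x. g x + h x - r x) < e"
      using kernel_span_add[OF V p(1) q(1)] by (intro bexI[of _ "\<lambda>x. p x + q x"]) (auto simp: algebra_simps)
  qed
  show "(\<lambda>x. c * h x) \<in> kernel_closed_span V" if h: "h \<in> kernel_closed_span V" for c h
    unfolding kernel_closed_span_iff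
  proof (intro conjI allI impI)
    show "(\<lambda>x. c * h x) \<in> da_space" using h sub by (auto intro: da.scale_in)
    fix e :: real assume e: "e > 0"
    then have "e / (cmod c + 1) > 0" by (simp add: add_nonneg_pos)
    then obtain p where p: "p \<in> kernel_span V" "da.nrm (\<lambda>x. h x - p x) < e / (cmod c + 1)"
      using h unfolding kernel_closed_span_iff by meson
    have m: "(\<lambda>x. h x - p x) \<in> da_space" using da.diff_mem sp[OF p(1)] sub h by blast
    have "da.nrm (\<lambda>x. c * h x - c * p x) = cmod c * da.nrm (\<lambda>x. h x - p x)"
      using da.nrm_scale[OF m, of c] by (simp add: algebra_simps)
    also have "\<dots> \<le> (cmod c + 1) * da.nrm (\<lambda>x. h x - p x)"
      using da.nrm_nonneg[OF m] by (intro mult_right_mono) auto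
    also have "\<dots> < e"
      using p(2) by (simp add: add_nonneg_pos pos_less_divide_eq mult.commute)
    finally show "\<exists>r\<in>kernel_span V. da.nrm (\<lambda>x. c * h x - r x) < e"
      using kernel_span_scale[OF V p(1), of c] by (intro bexI[of _ "\<lambda>x. c * p x"])
  qed
  show "h \<in> kernel_closed_span V"
    if s: "\<And>n::nat. s n \<in> kernel_closed_span V" and h: "h \<in> da_space"
      and lim: "(\<lambda>n. da.nrm (\<lambda>x. s n x - h x)) \<longlonglongrightarrow> 0" for s h
    unfolding kernel_closed_span_iff
  proof (intro conjI allI impI h)
    fix e :: real assume e: "e > 0"
    have "eventually (\<lambda>n. da.nrm (\<lambda>x. s n x - h x) < e / 2) sequentially"
      using order_tendstoD(2)[OF lim, of "e/2"] e by simp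
    then obtain n where n: "da.nrm (\<lambda>x. s n x - h x) < e / 2"
      by (auto simp: eventually_sequentially)
    obtain p where p: "p \<in> kernel_span V" "da.nrm (\<lambda>x. s n x - p x) < e / 2"
      using s[of n] e unfolding kernel_closed_span_iff by (meson half_gt_zero)
    have sn: "s n \<in> da_space" using s sub by blast
    have "da.nrm (\<lambda>x. h x - p x) < e"
      using da.nrm_triangle_diff[OF h sn sp[OF p(1)]] da.nrm_minus_commute[OF sn h] n p(2) by linarith
    then show "\<exists>g\<in>kernel_span V. da.nrm (\<lambda>x. h x - g x) < e" using p(1) by blast
  qed
qed

lemma disc_map_kernel_holomorphic:
  assumes f: "analytic_disc_map f" "f ` unit_disc \<subseteq> unit_ball" and y: "y \<in> unit_ball"
  shows "(\<lambda>z. da.ker y (f z)) holomorphic_on unit_disc"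
proof -
  have "(\<lambda>z. 1 / (1 - (\<Sum>i\<in>UNIV. f z $ i * cnj (y $ i)))) holomorphic_on unit_disc"
    using f herm_neq_1[OF _ y]
    by (intro holomorphic_intros) (auto simp: analytic_disc_map_def herm_def image_subset_iff)
  then show ?thesis
    by (rule holomorphic_transform) (use f in \<open>auto simp: res_def da_kernel_def herm_def image_subset_iff\<close>)
qed

lemma da_nrm_ker_sq:
  assumes "x \<in> unit_ball" shows "(da.nrm (da.ker x))\<^sup>2 = 1 / (1 - (norm x)\<^sup>2)"
proof -
  have "da_kernel x x = of_real (1 / (1 - (norm x)\<^sup>2))"
    by (simp add: da_kernel_def herm_self)
  then show ?thesis
    unfolding da.nrm_ker_sq[OF assms] by (simp only: Re_complex_of_real)
qed

text \<open>
  Point evaluations are bounded by \<open>\<parallel>k\<^sub>x\<parallel>\<^sup>2 = 1 / (1 - \<parallel>x\<parallel>\<^sup>2)\<close>, which is bounded along \<open>f\<close> on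
  compact subsets of the disc, so convergence in norm implies locally uniform convergence of the
  compositions.
\<close>

lemma disc_map_closed_span_holomorphic:
  assumes f: "analytic_disc_map f" "f ` unit_disc \<subseteq> unit_ball"
    and V: "V \<subseteq> unit_ball" and h: "h \<in> kernel_closed_span V"
  shows "(\<lambda>z. h (f z)) holomorphic_on unit_disc"
proof -
  have "\<forall>n. \<exists>g\<in>kernel_span V. da.nrm (\<lambda>x. h x - g x) < inverse (Suc n)"
    using h by (simp add: kernel_closed_span_iff)
  then obtain s where s: "\<And>n. s n \<in> kernel_span V"
    and close: "\<And>n. da.nrm (\<lambda>x. h x - s n x) < inverse (Suc n)" by metis
  have hd: "h \<in> da_space" using h by (simp add: kernel_closed_span_iff)
  have sd: "s n \<in> da_space" for n using kernel_span_subset[OF V] s by blast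
  have hol: "(\<lambda>z. s n (f z)) holomorphic_on unit_disc" for n
  proof -
    obtain F c where F: "finite F" "F \<subseteq> V" "s n = da.kcomb F c" using s[of n] V by (auto simp: kernel_span_mem_iff)
    have "(\<lambda>z. \<Sum>y\<in>F. c y * da.ker y (f z)) holomorphic_on unit_disc"
      using F V by (intro holomorphic_intros disc_map_kernel_holomorphic f) auto
    then show ?thesis by (simp add: F(3) da.kcomb_def)
  qed
  have "continuous_on unit_disc (\<lambda>z. \<chi> i. f z $ i)"
    using f(1) by (intro continuous_on_vec_lambda holomorphic_on_imp_continuous_on)
      (simp add: analytic_disc_map_def)
  then have cont: "continuous_on unit_disc f" by simp
  show ?thesis
  proof (rule holomorphic_uniform_sequence[OF open_ball hol])
    fix x :: complex assume x: "x \<in> unit_disc"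
    then obtain d where d: "d > 0" "cball x d \<subseteq> unit_disc" using open_ball[of "0::complex" 1, unfolded open_contains_cball] by blast
    have "compact ((\<lambda>z. norm (f z)) ` cball x d)"
      using d(2) by (intro compact_continuous_image continuous_intros continuous_on_subset[OF cont]) auto
    moreover have "(\<lambda>z. norm (f z)) ` cball x d \<noteq> {}" using d by simp
    ultimately obtain w where w: "w \<in> cball x d" "\<And>z. z \<in> cball x d \<Longrightarrow> norm (f z) \<le> norm (f w)"
      using compact_attains_sup[of "(\<lambda>z. norm (f z)) ` cball x d"] by auto
    define r where "r = norm (f w)"
    have r: "r < 1" "0 \<le> r" using w(1) d(2) f(2) by (auto simp: r_def image_subset_iff)
    define B where "B = sqrt (1 / (1 - r\<^sup>2))"
    have B: "da.nrm (da.ker (f z)) \<le> B" if z: "z \<in> cball x d" for z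
    proof -
      have fz: "f z \<in> unit_ball" using z d(2) f(2) by blast
      have "(da.nrm (da.ker (f z)))\<^sup>2 = 1 / (1 - (norm (f z))\<^sup>2)"
        by (rule da_nrm_ker_sq[OF fz])
      also have "\<dots> \<le> 1 / (1 - r\<^sup>2)"
      proof (rule divide_left_mono)
        have le: "(norm (f z))\<^sup>2 \<le> r\<^sup>2"
          using w(2)[OF z] by (simp add: r_def power_mono)
        have "r\<^sup>2 < 1" using r by (simp add: power_less_one_iff)
        with le show "0 < (1 - (norm (f z))\<^sup>2) * (1 - r\<^sup>2)" by (intro mult_pos_pos) auto
        from le show "1 - r\<^sup>2 \<le> 1 - (norm (f z))\<^sup>2" by simp
      qed simp
      finally show ?thesis unfolding B_def by (rule real_le_rsqrt)
    qed
    have "uniform_limit (cball x d) (\<lambda>n z. s n (f z)) (\<lambda>z. h (f z)) sequentially"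
    proof (rule uniform_limitI)
      fix e :: real assume e: "e > 0"
      have B0: "B \<ge> 0" using r by (simp add: B_def power_le_one)
      obtain N where N: "inverse (Suc N) < e / (B + 1)"
        using reals_Archimedean[of "e / (B + 1)"] e B0 by auto
      have "dist (s n (f z)) (h (f z)) < e" if n: "n \<ge> N" and z: "z \<in> cball x d" for n z
      proof -
        have fz: "f z \<in> unit_ball" using z d(2) f(2) by blast
        have "dist (s n (f z)) (h (f z)) \<le> da.nrm (\<lambda>x. h x - s n x) * da.nrm (da.ker (f z))"
          using da.eval_le[OF da.diff_mem[OF hd sd] fz, of n] by (simp add: dist_norm norm_minus_commute)
        also have "\<dots> \<le> inverse (Suc n) * B"
          using less_imp_le[OF close[of n]] B[OF z] B0 da.nrm_nonneg[OF da.kernel_mem[OF fz]] by (intro mult_mono) auto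
        also have "\<dots> \<le> inverse (Suc N) * B"
          using n B0 by (intro mult_right_mono le_imp_inverse_le) auto
        also have "\<dots> \<le> inverse (Suc N) * (B + 1)"
          by (intro mult_left_mono) auto
        also have "\<dots> < e"
          using N B0 pos_less_divide_eq[of "B + 1" "inverse (Suc N)" e] by simp
        finally show ?thesis .
      qed
      then show "\<forall>\<^sub>F n in sequentially. \<forall>z\<in>cball x d. dist (s n (f z)) (h (f z)) < e"
        unfolding eventually_sequentially by blast
    qed
    with d show "\<exists>d>0. cball x d \<subseteq> unit_disc \<and>
        uniform_limit (cball x d) (\<lambda>n z. s n (f z)) (\<lambda>z. h (f z)) sequentially" by blast
  qed
qed

section \<open>A disc whose boundary crosses itself\<close>

definition blaschke :: "complex \<Rightarrow> complex" where
  "blaschke z = z * (2 * z - 1) / (2 - z)"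

definition crossing_disc :: "complex \<Rightarrow> complex ^ 2" where
  "crossing_disc z = vector [z\<^sup>2 / sqrt 2, blaschke z / sqrt 2]"

lemma crossing_disc_1 [simp]: "crossing_disc z $ 1 = z\<^sup>2 / sqrt 2"
  and crossing_disc_2 [simp]: "crossing_disc z $ 2 = blaschke z / sqrt 2"
  by (simp_all add: crossing_disc_def)

text \<open>
  This identity exhibits the modulus of the Blaschke product as below, equal to or above one
  according to \<open>cmod z\<close>, and quantifies the approach to the circle.
\<close>

lemma norm_blaschke_sq:
  assumes "z \<noteq> 2"
  shows "(cmod (blaschke z))\<^sup>2 = (cmod z)\<^sup>2 * (1 - 3 * (1 - (cmod z)\<^sup>2) / (cmod (2 - z))\<^sup>2)"
proof -
  have "(cmod (2 * z - 1))\<^sup>2 = (cmod (2 - z))\<^sup>2 - 3 * (1 - (cmod z)\<^sup>2)"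
    by (simp add: cmod_power2) (simp add: power2_eq_square algebra_simps)
  then have "(cmod (blaschke z))\<^sup>2
      = (cmod z)\<^sup>2 * (((cmod (2 - z))\<^sup>2 - 3 * (1 - (cmod z)\<^sup>2)) / (cmod (2 - z))\<^sup>2)"
    by (simp add: blaschke_def norm_mult norm_divide power_mult_distrib power_divide)
  also have "((cmod (2 - z))\<^sup>2 - 3 * (1 - (cmod z)\<^sup>2)) / (cmod (2 - z))\<^sup>2
      = 1 - 3 * (1 - (cmod z)\<^sup>2) / (cmod (2 - z))\<^sup>2"
    using assms by (subst diff_divide_distrib) simp
  finally show ?thesis .
qed

lemma norm_2_minus_ge: "cmod z \<le> 1 \<Longrightarrow> 1 \<le> cmod (2 - z)"
  using norm_triangle_ineq2[of 2 z] by simp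

lemma norm_blaschke_le:
  assumes "cmod z \<le> 1"
  shows "(cmod (blaschke z))\<^sup>2 \<le> (cmod z)\<^sup>2"
    "(cmod z)\<^sup>2 * (1 - 3 * (1 - (cmod z)\<^sup>2)) \<le> (cmod (blaschke z))\<^sup>2"
proof -
  have z2: "z \<noteq> 2" using assms by auto
  have n: "1 \<le> (cmod (2 - z))\<^sup>2"
    using norm_2_minus_ge[OF assms] by (simp add: one_le_power)
  have r: "0 \<le> 1 - (cmod z)\<^sup>2" using assms by (simp add: power_le_one)
  have "0 \<le> 3 * (1 - (cmod z)\<^sup>2) / (cmod (2 - z))\<^sup>2" using r by simp
  moreover have "3 * (1 - (cmod z)\<^sup>2) / (cmod (2 - z))\<^sup>2 \<le> 3 * (1 - (cmod z)\<^sup>2) / 1"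
    using r n by (intro divide_left_mono) auto
  ultimately show "(cmod (blaschke z))\<^sup>2 \<le> (cmod z)\<^sup>2"
    "(cmod z)\<^sup>2 * (1 - 3 * (1 - (cmod z)\<^sup>2)) \<le> (cmod (blaschke z))\<^sup>2"
    unfolding norm_blaschke_sq[OF z2] by (auto intro!: mult_left_le mult_left_mono)
qed

lemma norm_blaschke_ge_1: "z \<noteq> 2 \<Longrightarrow> 1 \<le> cmod z \<Longrightarrow> 1 \<le> cmod (blaschke z)"
proof -
  assume z: "z \<noteq> 2" "1 \<le> cmod z"
  have "1 * 1 \<le> (cmod z)\<^sup>2 * (1 - 3 * (1 - (cmod z)\<^sup>2) / (cmod (2 - z))\<^sup>2)"
    using z by (intro mult_mono) (auto simp: one_le_power divide_nonpos_nonneg)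
  then have "1\<^sup>2 \<le> (cmod (blaschke z))\<^sup>2" using norm_blaschke_sq[OF z(1)] by simp
  then show ?thesis by (rule power2_le_imp_le) simp
qed

lemma norm_crossing_disc_sq: "(norm (crossing_disc z))\<^sup>2 = ((cmod z) ^ 4 + (cmod (blaschke z))\<^sup>2) / 2"
  by (simp add: norm_sq_vec sum_2 norm_divide norm_power power_divide add_divide_distrib)

lemma norm_blaschke_lt_1: "cmod z < 1 \<Longrightarrow> cmod (blaschke z) < 1"
proof -
  assume z: "cmod z < 1"
  then have "(cmod z)\<^sup>2 < 1" by (simp add: power_less_one_iff)
  then have "(cmod (blaschke z))\<^sup>2 < 1\<^sup>2"
    using norm_blaschke_le(1)[OF less_imp_le[OF z]] by (metis le_less_trans power_one)
  then show ?thesis by (rule power2_less_imp_less) simp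
qed

lemma norm_crossing_disc_lt_1: "cmod z < 1 \<Longrightarrow> norm (crossing_disc z) < 1"
proof -
  assume z: "cmod z < 1"
  have "(cmod z) ^ 4 < 1" "(cmod (blaschke z))\<^sup>2 < 1"
    using z norm_blaschke_lt_1[OF z] by (simp_all add: power_less_one_iff)
  then have "(norm (crossing_disc z))\<^sup>2 < 1\<^sup>2" by (simp add: norm_crossing_disc_sq)
  then show ?thesis by (rule power2_less_imp_less) simp
qed

lemma crossing_disc_ball: "crossing_disc ` unit_disc \<subseteq> unit_ball"
  by (auto simp: norm_crossing_disc_lt_1)

lemma crossing_disc_proper: "proper_disc_map crossing_disc"
  unfolding proper_disc_map_def
proof (intro conjI crossing_disc_ball)
  let ?F = "filtercomap cmod (at_left 1)"
  have c: "filterlim cmod (at_left 1) ?F" by (rule filterlim_filtercomap)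
  then have c1: "(cmod \<longlongrightarrow> 1) ?F" by (rule filterlim_mono) (auto simp: at_within_le_nhds)
  have lt: "\<forall>\<^sub>F z in ?F. cmod z < 1"
    using c by (auto simp: filterlim_at elim: eventually_mono)
  have "((\<lambda>z. (norm (crossing_disc z))\<^sup>2) \<longlongrightarrow> 1) ?F"
  proof (rule tendsto_sandwich)
    show "\<forall>\<^sub>F z in ?F. ((cmod z) ^ 4 + (cmod z)\<^sup>2 * (1 - 3 * (1 - (cmod z)\<^sup>2))) / 2 \<le> (norm (crossing_disc z))\<^sup>2"
      using lt by eventually_elim (use norm_blaschke_le in \<open>simp add: norm_crossing_disc_sq\<close>)
    show "\<forall>\<^sub>F z in ?F. (norm (crossing_disc z))\<^sup>2 \<le> ((cmod z) ^ 4 + (cmod z)\<^sup>2) / 2"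
      using lt by eventually_elim (use norm_blaschke_le in \<open>simp add: norm_crossing_disc_sq\<close>)
    show "((\<lambda>z. ((cmod z) ^ 4 + (cmod z)\<^sup>2 * (1 - 3 * (1 - (cmod z)\<^sup>2))) / 2) \<longlongrightarrow> 1) ?F"
      by (rule tendsto_eq_intros c1 refl | simp)+
    show "((\<lambda>z. ((cmod z) ^ 4 + (cmod z)\<^sup>2) / 2) \<longlongrightarrow> 1) ?F"
      by (rule tendsto_eq_intros c1 refl | simp)+
  qed
  then have "((\<lambda>z. sqrt ((norm (crossing_disc z))\<^sup>2)) \<longlongrightarrow> sqrt 1) ?F"
    by (rule tendsto_real_sqrt)
  then show "((\<lambda>z. norm (crossing_disc z)) \<longlongrightarrow> 1) ?F" by simp
qed

lemma blaschke_has_derivative: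
  assumes "z \<noteq> 2"
  shows "(blaschke has_field_derivative (8 * z - 2 * z\<^sup>2 - 2) / (2 - z)\<^sup>2) (at z)"
proof -
  have "((\<lambda>z. z * (2 * z - 1)) has_field_derivative 4 * z - 1) (at z)"
    "((\<lambda>z. 2 - z) has_field_derivative - 1) (at z)"
    by (auto intro!: derivative_eq_intros)
  then have "(blaschke has_field_derivative
      ((4 * z - 1) * (2 - z) - z * (2 * z - 1) * - 1) / ((2 - z) * (2 - z))) (at z)"
    unfolding blaschke_def[abs_def] using assms by (intro DERIV_divide) auto
  also have "((4 * z - 1) * (2 - z) - z * (2 * z - 1) * - 1) = 8 * z - 2 * z\<^sup>2 - 2"
    by (simp add: algebra_simps power2_eq_square)
  finally show ?thesis by (simp add: power2_eq_square)
qed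

lemma crossing_disc_has_derivative:
  fixes z :: complex
  assumes "z \<noteq> 2"
  shows "((\<lambda>z. crossing_disc z $ 1) has_field_derivative 2 * z / sqrt 2) (at z)"
    "((\<lambda>z. crossing_disc z $ 2) has_field_derivative (8 * z - 2 * z\<^sup>2 - 2) / (2 - z)\<^sup>2 / sqrt 2) (at z)"
  unfolding crossing_disc_1 crossing_disc_2
  using DERIV_cdivide[OF blaschke_has_derivative[OF assms], of "sqrt 2"]
  by (auto intro!: derivative_eq_intros)

lemma crossing_disc_differentiable:
  assumes "cmod z \<le> 1"
  shows "(\<lambda>w. crossing_disc w $ i) field_differentiable (at z within A)"
proof -
  have "z \<noteq> 2" using assms by auto
  then have "(\<lambda>w. crossing_disc w $ i) field_differentiable (at z)"
    using crossing_disc_has_derivative[of z] exhaust_2[of i] by (auto simp: field_differentiable_def)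
  then show ?thesis by (rule field_differentiable_at_within)
qed

lemma crossing_disc_analytic: "analytic_disc_map crossing_disc"
  unfolding analytic_disc_map_def holomorphic_on_def
  by (auto intro: crossing_disc_differentiable)

lemma crossing_disc_rational: "rational_poles_off crossing_disc (cball 0 1)"
  unfolding rational_poles_off_def
proof (rule exI, rule exI, rule allI)
  define p :: "2 \<Rightarrow> complex poly" where "p = (\<lambda>i. if i = 1 then [:0, 0, 1:] else [:0, -1, 2:])"
  define q :: "2 \<Rightarrow> complex poly" where "q = (\<lambda>i. if i = 1 then [:sqrt 2:] else smult (sqrt 2) [:2, -1:])"
  fix i :: 2
  have "i = 1 \<or> i = 2" by (rule exhaust_2)
  then show "q i \<noteq> 0 \<and> (\<forall>z\<in>cball 0 1. poly (q i) z \<noteq> 0) \<and>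
      (\<forall>z. crossing_disc z $ i = poly (p i) z / poly (q i) z)"
    by (auto simp: p_def q_def blaschke_def power2_eq_square algebra_simps)
qed

text \<open>
  On the circle \<open>w = cnj z\<close> is the inverse of \<open>z\<close>.  Replacing each \<open>1\<close> in the logarithmic
  derivative of the Blaschke product by \<open>z w\<close> turns it into
  \<open>(8 - 4 Re z) / \<bar>2 - z\<bar>\<^sup>2\<close>, which is positive.
\<close>

lemma crossing_disc_transversal: "meets_boundary_transversally crossing_disc"
  unfolding meets_boundary_transversally_def
proof (intro allI impI)
  fix z :: complex assume z: "cmod z = 1"
  define w where "w = cnj z"
  have zw: "z * w = 1" using z by (simp add: w_def mult_cnj_self)
  have z2: "z \<noteq> 2" "w \<noteq> 2" using z by (auto simp: w_def complex_cnj_cancel_iff dest: arg_cong[of _ _ cmod])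
  have d1: "cderiv crossing_disc z $ 1 = 2 * z / sqrt 2"
    and d2: "cderiv crossing_disc z $ 2 = (8 * z - 2 * z\<^sup>2 - 2) / (2 - z)\<^sup>2 / sqrt 2"
    unfolding cderiv_def using crossing_disc_has_derivative[OF z2(1)] by (auto intro: DERIV_imp_deriv)
  have s: "complex_of_real (sqrt 2) * complex_of_real (sqrt 2) = 2"
    by (simp flip: of_real_mult)
  have half: "a / sqrt 2 * (b / sqrt 2) = a * b / 2" for a b :: complex
    by (simp only: times_divide_times_eq s)
  have "cnj (herm (crossing_disc z) (cderiv crossing_disc z))
      = w\<^sup>2 / sqrt 2 * (2 * z / sqrt 2)
        + w * (2 * w - 1) / (2 - w) / sqrt 2 * ((8 * z - 2 * z\<^sup>2 - 2) / (2 - z)\<^sup>2 / sqrt 2)"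
    by (simp add: herm_def sum_2 d1 d2 blaschke_def w_def)
  then have "2 * (z * cnj (herm (crossing_disc z) (cderiv crossing_disc z)))
      = z * (w\<^sup>2 * (2 * z)) + z * (w * (2 * w - 1) / (2 - w) * ((8 * z - 2 * z\<^sup>2 - 2) / (2 - z)\<^sup>2))"
    by (simp only: half) (simp add: distrib_left)
  also have "z * (w\<^sup>2 * (2 * z)) = 2 * (z * w)\<^sup>2" by (simp add: power2_eq_square)
  also have "\<dots> = 2" by (simp add: zw)
  also have "z * (w * (2 * w - 1) / (2 - w) * ((8 * z - 2 * z\<^sup>2 - 2) / (2 - z)\<^sup>2))
      = (z * w) * (2 * w - z * w) * (8 * z - 2 * z\<^sup>2 - 2 * (z * w)) / ((2 - w) * (2 - z)\<^sup>2)"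
    by (simp add: zw)
  also have "\<dots> = (z * w) * w * z * (2 - z) * (8 - 2 * z - 2 * w) / ((2 - w) * (2 - z)\<^sup>2)"
    by (simp add: power2_eq_square algebra_simps)
  also have "\<dots> = (z * w) * (z * w) * (8 - 2 * z - 2 * w) / ((2 - w) * (2 - z))"
    using z2 by (simp add: power2_eq_square)
  also have "\<dots> = (8 - 2 * (z + cnj z)) / ((2 - z) * cnj (2 - z))"
    unfolding zw by (simp add: w_def algebra_simps)
  also have "\<dots> = of_real ((8 - 4 * Re z) / (cmod (2 - z))\<^sup>2)"
    unfolding mult_cnj_self complex_add_cnj by simp
  finally have "2 * (z * cnj (herm (crossing_disc z) (cderiv crossing_disc z)))
     = of_real (2 + (8 - 4 * Re z) / (cmod (2 - z))\<^sup>2)" by simp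
  moreover have "2 + (8 - 4 * Re z) / (cmod (2 - z))\<^sup>2 > 0"
    using complex_Re_le_cmod[of z] z by (intro add_pos_nonneg) auto
  ultimately show "herm (crossing_disc z) (cderiv crossing_disc z) \<noteq> 0"
    by (metis complex_cnj_zero less_irrefl mult_zero_right of_real_eq_0_iff)
qed

section \<open>The image of the disc and its inverse\<close>

text \<open>
  The rational left inverse of \<open>crossing_disc\<close>, obtained by solving
  \<open>z (1 - v) = 2 (u - v)\<close> for \<open>z\<close>.
\<close>

definition disc_coordinate :: "complex ^ 2 \<Rightarrow> complex" where
  "disc_coordinate x = 2 * (sqrt 2 * x $ 1 - sqrt 2 * x $ 2) / (1 - sqrt 2 * x $ 2)"

lemma blaschke_eq_1_iff: "z \<noteq> 2 \<Longrightarrow> blaschke z = 1 \<longleftrightarrow> z = 1 \<or> z = -1"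
proof -
  assume z: "z \<noteq> 2"
  have "blaschke z = 1 \<longleftrightarrow> 2 * ((z - 1) * (z + 1)) = 0"
    using z by (simp add: blaschke_def divide_eq_1_iff algebra_simps)
  then show ?thesis by (auto simp: eq_neg_iff_add_eq_0)
qed

lemma disc_coordinate_crossing_disc:
  assumes "z \<noteq> 2" "blaschke z \<noteq> 1"
  shows "disc_coordinate (crossing_disc z) = z"
proof -
  have "blaschke z * (2 - z) = z * (2 * z - 1)" using assms(1) by (simp add: blaschke_def)
  then have "2 * (z\<^sup>2 - blaschke z) = z * (1 - blaschke z)"
    by (simp add: algebra_simps power2_eq_square)
  then show ?thesis
    using assms(2) by (simp add: disc_coordinate_def)
qed

lemma disc_coordinate_on_disc: "cmod z < 1 \<Longrightarrow> disc_coordinate (crossing_disc z) = z"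
  using norm_blaschke_lt_1[of z] by (intro disc_coordinate_crossing_disc) auto

lemma crossing_disc_inj: "inj_on crossing_disc unit_disc"
  by (rule inj_on_inverseI[of _ disc_coordinate]) (simp add: disc_coordinate_on_disc)

lemma crossing_disc_almost_inj:
  assumes "cmod z \<le> 1" "cmod w \<le> 1" "crossing_disc z = crossing_disc w"
  shows "z = w \<or> (z = 1 \<and> w = -1) \<or> (z = -1 \<and> w = 1)"
proof -
  have z2: "z \<noteq> 2" "w \<noteq> 2" using assms by auto
  have b: "blaschke z = blaschke w" using assms(3) by (simp add: vec_eq_iff forall_2)
  show ?thesis
  proof (cases "blaschke z = 1")
    case True
    then show ?thesis using blaschke_eq_1_iff z2 b by metis
  next
    case False
    then show ?thesis
      using disc_coordinate_crossing_disc z2 b assms(3) by metis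
  qed
qed

lemma crossing_disc_crosses: "crossing_disc 1 = crossing_disc (-1)"
  by (simp add: vec_eq_iff forall_2 blaschke_def)

text \<open>
  The polynomial is what remains of \<open>u = z\<^sup>2\<close> after inserting \<open>z = 2 (u - v) / (1 - v)\<close>.
  Conversely, a zero with \<open>v = 1\<close> has \<open>u = 1\<close> and lies on the sphere.  Any other zero has the form
  \<open>(z\<^sup>2, b z) / \<surd>2\<close>, and \<open>1 \<le> cmod z\<close> would make both components too large for the ball.
\<close>

lemma image_crossing_disc:
  "crossing_disc ` unit_disc = {x \<in> unit_ball.
     sqrt 2 * x $ 1 * (1 - sqrt 2 * x $ 2)\<^sup>2 = 4 * (sqrt 2 * x $ 1 - sqrt 2 * x $ 2)\<^sup>2}" (is "_ = ?R")
proof (intro equalityI subsetI)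
  fix x assume x: "x \<in> crossing_disc ` unit_disc"
  then obtain z where z: "x = crossing_disc z" "cmod z < 1" by auto
  have "z \<noteq> 2" using z by auto
  then have "blaschke z * (2 - z) = z * (2 * z - 1)" by (simp add: blaschke_def)
  then have "2 * (z\<^sup>2 - blaschke z) = z * (1 - blaschke z)"
    by (simp add: algebra_simps power2_eq_square)
  then have "(2 * (z\<^sup>2 - blaschke z))\<^sup>2 = (z * (1 - blaschke z))\<^sup>2" by simp
  then have "z\<^sup>2 * (1 - blaschke z)\<^sup>2 = 4 * (z\<^sup>2 - blaschke z)\<^sup>2"
    by (simp only: power_mult_distrib) simp
  then show "x \<in> ?R" using norm_crossing_disc_lt_1[OF z(2)] by (simp add: z(1))
next
  fix x assume x: "x \<in> ?R"
  define u where "u = sqrt 2 * x $ 1"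
  define v where "v = sqrt 2 * x $ 2"
  have eq: "u * (1 - v)\<^sup>2 = 4 * (u - v)\<^sup>2" using x by (simp add: u_def v_def)
  have xu: "x $ 1 = u / sqrt 2" "x $ 2 = v / sqrt 2" by (simp_all add: u_def v_def)
  have "(norm x)\<^sup>2 < 1\<^sup>2" using x by (intro power_strict_mono) auto
  then have lt: "(cmod u)\<^sup>2 + (cmod v)\<^sup>2 < 2"
    by (simp add: norm_sq_vec sum_2 xu norm_divide power_divide)
  have v1: "v \<noteq> 1"
  proof
    assume v: "v = 1"
    with eq have "u = 1" by simp
    with v lt show False by simp
  qed
  define z where "z = 2 * (u - v) / (1 - v)"
  have zv: "z * (1 - v) = 2 * (u - v)" using v1 by (simp add: z_def)
  have "z\<^sup>2 * (1 - v)\<^sup>2 = (2 * (u - v))\<^sup>2"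
    by (simp only: power_mult_distrib[symmetric] zv)
  also have "\<dots> = u * (1 - v)\<^sup>2"
    unfolding eq by (simp only: power_mult_distrib) simp
  finally have "z\<^sup>2 * (1 - v)\<^sup>2 = u * (1 - v)\<^sup>2" .
  then have u: "u = z\<^sup>2" using v1 by simp
  have vz: "v * (2 - z) = z * (2 * z - 1)"
    using zv u by (simp add: algebra_simps power2_eq_square)
  then have z2: "z \<noteq> 2" by auto
  then have v: "v = blaschke z" using vz by (simp add: blaschke_def field_simps)
  have x_eq: "x = crossing_disc z"
    by (simp add: vec_eq_iff forall_2 xu u v)
  have "cmod z < 1"
  proof (rule ccontr)
    assume "\<not> cmod z < 1"
    then have z: "1 \<le> cmod z" by simp
    have "1 \<le> (cmod u)\<^sup>2" "1 \<le> (cmod v)\<^sup>2"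
      using z norm_blaschke_ge_1[OF z2 z] by (auto simp: u v norm_power intro!: one_le_power)
    with lt show False by linarith
  qed
  then show "x \<in> crossing_disc ` unit_disc" using x_eq by auto
qed

lemma crossing_disc_variety: "variety (crossing_disc ` unit_disc)"
proof -
  define P where "P = (\<lambda>x :: complex ^ 2. sqrt 2 * x $ 1 * (1 + (- sqrt 2) * x $ 2) * (1 + (- sqrt 2) * x $ 2)
     + (-4) * ((sqrt 2 * x $ 1 + (- sqrt 2) * x $ 2) * (sqrt 2 * x $ 1 + (- sqrt 2) * x $ 2)))"
  have "res unit_ball P \<in> da_multipliers"
    unfolding P_def
    by (intro da_multipliers_add da_multipliers_mult da_multipliers_const coordinate_multiplier)
  moreover have "crossing_disc ` unit_disc = {x \<in> unit_ball. \<forall>h\<in>{res unit_ball P}. h x = 0}"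
    unfolding image_crossing_disc by (auto simp: res_def P_def power2_eq_square algebra_simps)
  ultimately show ?thesis unfolding variety_def by blast
qed

lemma holomorphic_multi_on_compose:
  assumes "open S" "\<And>x. x \<in> S \<Longrightarrow> \<exists>L. (G has_derivative L) (at x) \<and> (\<forall>c v. L (c *s v) = c * L v)"
    and "g holomorphic_on T" "open T" "G ` S \<subseteq> T"
  shows "holomorphic_multi_on (\<lambda>x. g (G x)) S"
  unfolding holomorphic_multi_on_def
proof
  fix x assume x: "x \<in> S"
  obtain L where L: "(G has_derivative L) (at x)" "\<And>c v. L (c *s v) = c * L v" using assms(2)[OF x] by blast
  have "(g has_field_derivative deriv g (G x)) (at (G x))"
    using assms(3,4,5) x by (intro holomorphic_derivI[of _ T]) auto
  then have "(g has_derivative (*) (deriv g (G x))) (at (G x))"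
    by (simp add: has_field_derivative_def)
  from has_derivative_compose[OF L(1) this] L(2)
  show "\<exists>L. ((\<lambda>x. g (G x)) has_derivative L) (at x) \<and> (\<forall>c v. L (c *s v) = c * L v)"
    by (intro exI[of _ "\<lambda>y. deriv g (G x) * L y"]) (simp add: algebra_simps)
qed

lemma disc_coordinate_differentiable:
  fixes x :: "complex ^ 2"
  assumes "sqrt 2 * x $ 2 \<noteq> 1"
  shows "\<exists>L. (disc_coordinate has_derivative L) (at x) \<and> (\<forall>c v. L (c *s v) = c * L v)"
proof -
  define N where "N = (\<lambda>x :: complex ^ 2. 2 * (sqrt 2 * x $ 1 - sqrt 2 * x $ 2))"
  define D where "D = (\<lambda>x :: complex ^ 2. 1 - sqrt 2 * x $ 2)"
  have D: "D x \<noteq> 0" using assms by (simp add: D_def)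
  have co: "((\<lambda>x :: complex ^ 2. x $ i) has_derivative (\<lambda>x. x $ i)) (at x)" for i
    by (rule bounded_linear.has_derivative[OF bounded_linear_vec_nth has_derivative_ident])
  have dN: "(N has_derivative N) (at x)"
    unfolding N_def by (intro has_derivative_mult_right has_derivative_diff co)
  have dD: "(D has_derivative (\<lambda>v. 0 - sqrt 2 * v $ 2)) (at x)"
    unfolding D_def by (intro has_derivative_mult_right has_derivative_diff has_derivative_const co)
  from has_derivative_divide[OF dN dD D]
  have "(disc_coordinate has_derivative
      (\<lambda>v. - N x * (inverse (D x) * (0 - sqrt 2 * v $ 2) * inverse (D x)) + N v / D x)) (at x)"
    by (simp add: disc_coordinate_def[abs_def] N_def D_def)
  then show ?thesis
    by (intro exI conjI) (assumption, simp add: N_def divide_inverse algebra_simps)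
qed

text \<open>
  The rational inverse is defined near each point of the image and maps a neighbourhood into the
  disc, so that \<open>g\<close> composed with it extends \<open>\<phi>\<close>.
\<close>

lemma holomorphic_on_image_crossing_disc:
  assumes g: "g holomorphic_on unit_disc" and eq: "\<And>z. z \<in> unit_disc \<Longrightarrow> \<phi> (crossing_disc z) = g z"
  shows "holomorphic_on_variety \<phi> (crossing_disc ` unit_disc)"
  unfolding holomorphic_on_variety_def
proof
  fix p assume "p \<in> crossing_disc ` unit_disc"
  then obtain z where z: "p = crossing_disc z" "cmod z < 1" by auto
  define U where "U = {x :: complex ^ 2. sqrt 2 * x $ 2 \<noteq> 1}"
  have U: "open U" unfolding U_def by (intro open_Collect_neq continuous_intros)
  have pU: "p \<in> U" using norm_blaschke_lt_1[OF z(2)] by (auto simp: U_def z(1))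
  have dif: "\<exists>L. (disc_coordinate has_derivative L) (at x) \<and> (\<forall>c v. L (c *s v) = c * L v)" if "x \<in> U" for x
    using disc_coordinate_differentiable that by (simp add: U_def)
  have cont: "continuous_on U disc_coordinate"
    using dif by (intro continuous_at_imp_continuous_on) (blast intro: has_derivative_continuous)
  have "open (disc_coordinate -` unit_disc \<inter> U)"
    using continuous_open_preimage[OF cont U open_ball, of 0 1] by (simp add: Int_commute)
  moreover have "p \<in> disc_coordinate -` unit_disc \<inter> U"
    using pU z by (simp add: disc_coordinate_on_disc)
  ultimately obtain r where r: "r > 0" "ball p r \<subseteq> disc_coordinate -` unit_disc \<inter> U"
    unfolding open_contains_ball by blast
  have "holomorphic_multi_on (\<lambda>x. g (disc_coordinate x)) (ball p r)"
    using r by (intro holomorphic_multi_on_compose[OF _ _ g]) (use dif in auto)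
  moreover have "\<forall>x\<in>crossing_disc ` unit_disc \<inter> ball p r. \<phi> x = g (disc_coordinate x)"
    using eq by (auto simp: disc_coordinate_on_disc)
  ultimately show "\<exists>r>0. \<exists>G. holomorphic_multi_on G (ball p r) \<and> (\<forall>x\<in>crossing_disc ` unit_disc \<inter> ball p r. \<phi> x = G x)"
    using r(1) by blast
qed

lemma inverse_crossing_disc: "z \<in> unit_disc \<Longrightarrow> inv_into unit_disc crossing_disc (crossing_disc z) = z"
  by (rule inv_into_f_f[OF crossing_disc_inj])

lemma crossing_disc_biholomorphism: "disc_biholomorphism crossing_disc (crossing_disc ` unit_disc)"
  unfolding disc_biholomorphism_def
proof (intro conjI crossing_disc_analytic)
  show "bij_betw crossing_disc unit_disc (crossing_disc ` unit_disc)"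
    using crossing_disc_inj by (rule inj_on_imp_bij_betw)
  show "holomorphic_on_variety (inv_into unit_disc crossing_disc) (crossing_disc ` unit_disc)"
    by (rule holomorphic_on_image_crossing_disc[where g = "\<lambda>z. z"]) (auto simp: inverse_crossing_disc)
qed

lemma inverse_in_H_infinity:
  "res (crossing_disc ` unit_disc) (inv_into unit_disc crossing_disc) \<in> H_infinity (crossing_disc ` unit_disc)"
  unfolding H_infinity_def
proof (intro CollectI conjI allI impI)
  let ?\<phi> = "res (crossing_disc ` unit_disc) (inv_into unit_disc crossing_disc)"
  show "?\<phi> x = 0" if "x \<notin> crossing_disc ` unit_disc" for x using that by (simp add: res_def)
  show "holomorphic_on_variety ?\<phi> (crossing_disc ` unit_disc)"
    by (rule holomorphic_on_image_crossing_disc[where g = "\<lambda>z. z"]) (auto simp: inverse_crossing_disc res_def)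
  have "?\<phi> ` crossing_disc ` unit_disc \<subseteq> unit_disc"
    by (auto simp: inverse_crossing_disc res_def)
  then show "bounded (?\<phi> ` crossing_disc ` unit_disc)"
    using bounded_ball bounded_subset by blast
qed

section \<open>The multiplier algebra of the image\<close>

lemma variety_multipliers_subset:
  "variety_multipliers (crossing_disc ` unit_disc) \<subseteq> H_infinity (crossing_disc ` unit_disc)"
proof
  let ?V = "crossing_disc ` unit_disc"
  let ?M = "kernel_closed_span ?V"
  note V = crossing_disc_ball
  interpret M: rkhs_subspace unit_ball da_kernel da_space da_ip ?M
    by (rule rkhs_subspace_closed_span[OF V])
  fix \<phi> assume "\<phi> \<in> variety_multipliers ?V"
  then have \<phi>: "\<phi> \<in> multipliers ?V (res ?V ` ?M)" by (simp add: variety_multipliers_def variety_space_def)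
  have zero: "crossing_disc 0 = 0" by (simp add: vec_eq_iff forall_2 blaschke_def)
  have "0 \<in> ?V" using zero by (metis centre_in_ball imageI zero_less_one)
  then have k0: "da.ker 0 \<in> ?M" by (rule ker_mem_closed_span[OF V])
  obtain h where h: "h \<in> ?M" "\<And>x. x \<in> ?V \<Longrightarrow> h x = \<phi> x * da.ker 0 x"
    using M.restricted_multiplierD[OF \<phi> k0] by blast
  have h_eq: "h x = \<phi> x" if "x \<in> ?V" for x
    using h(2)[OF that] V that by (auto simp: res_def da_kernel_def herm_def)
  have "holomorphic_on_variety \<phi> ?V"
    by (rule holomorphic_on_image_crossing_disc[OF
          disc_map_closed_span_holomorphic[OF crossing_disc_analytic V V h(1)]])
      (simp add: h_eq)
  moreover have "bounded (\<phi> ` ?V)"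
  proof (rule M.restricted_multiplier_bounded[OF V _ _ \<phi>])
    show "da.ker y \<in> ?M" if "y \<in> ?V" for y using ker_mem_closed_span[OF V that] .
    show "da_kernel y y \<noteq> 0" if "y \<in> ?V" for y
      using herm_neq_1[of y y] V that by (auto simp: da_kernel_def)
  qed
  ultimately show "\<phi> \<in> H_infinity ?V"
    using \<phi> by (auto simp: H_infinity_def multipliers_def)
qed

definition real_blaschke :: "real \<Rightarrow> real" where
  "real_blaschke t = t * (2 * t - 1) / (2 - t)"

lemma blaschke_of_real: "blaschke (of_real t) = of_real (real_blaschke t)"
  by (simp add: blaschke_def real_blaschke_def)

lemma da_kernel_crossing_disc_real:
  "da_kernel (crossing_disc (of_real s)) (crossing_disc (of_real t))
     = of_real (1 / (1 - (s\<^sup>2 * t\<^sup>2 + real_blaschke s * real_blaschke t) / 2))"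
  by (simp add: da_kernel_def herm_def sum_2 blaschke_of_real add_divide_distrib flip: of_real_mult of_real_power)

text \<open>
  The speeds \<open>5\<close> and \<open>9\<close> match the two branches at the crossing point.  There
  \<open>z f'(z)\<close> has normal component \<open>(2 + 4) / 2 = 3\<close> at \<open>z = 1\<close> and \<open>(2 + 4/3) / 2 = 5/3\<close> at
  \<open>z = -1\<close>, and \<open>5 \<cdot> 3 = 9 \<cdot> 5/3\<close>.  Hence \<open>1 / k\<close> is \<open>30 e + O(e\<^sup>2)\<close> for all three pairs of
  arguments, and the ratios of the kernel values tend to \<open>1\<close>.
\<close>

lemma kernel_ratio_tendsto:
  defines "k \<equiv> \<lambda>s t. 1 / (1 - (s\<^sup>2 * t\<^sup>2 + real_blaschke s * real_blaschke t) / 2)"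
  shows "((\<lambda>e. (k (1 - 5 * e) (1 - 5 * e) - 2 * k (1 - 5 * e) (- (1 - 9 * e))
      + k (- (1 - 9 * e)) (- (1 - 9 * e))) / k (1 - 5 * e) (1 - 5 * e)) \<longlongrightarrow> 0) (at_right 0)"
  unfolding k_def real_blaschke_def by real_asymp

lemma inverse_not_multiplier:
  "res (crossing_disc ` unit_disc) (inv_into unit_disc crossing_disc)
     \<notin> variety_multipliers (crossing_disc ` unit_disc)"
proof
  let ?V = "crossing_disc ` unit_disc"
  let ?M = "kernel_closed_span ?V"
  let ?\<phi> = "res ?V (inv_into unit_disc crossing_disc)"
  note V = crossing_disc_ball
  interpret M: rkhs_subspace unit_ball da_kernel da_space da_ip ?M
    by (rule rkhs_subspace_closed_span[OF V])
  assume "?\<phi> \<in> variety_multipliers ?V"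
  then have \<phi>: "?\<phi> \<in> multipliers ?V (res ?V ` ?M)" by (simp add: variety_multipliers_def variety_space_def)
  define I where "I = {0 <..< 1/18 :: real}"
  define a where "a = (\<lambda>e :: real. complex_of_real (1 - 5 * e))"
  define b where "b = (\<lambda>e :: real. complex_of_real (- (1 - 9 * e)))"
  define k where "k = (\<lambda>s t. 1 / (1 - (s\<^sup>2 * t\<^sup>2 + real_blaschke s * real_blaschke t) / 2))"
  have ab: "cmod (a e) < 1" "cmod (b e) < 1" if "e \<in> I" for e
    unfolding a_def b_def norm_of_real using that by (auto simp: I_def abs_if)
  have phi: "?\<phi> (crossing_disc z) = z" if "cmod z < 1" for z
    using that by (simp add: res_def inverse_crossing_disc)
  have "\<exists>C. \<forall>e\<in>I. da.nrm (da.ker (crossing_disc (a e)))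
      \<le> C * da.nrm (\<lambda>z. da.ker (crossing_disc (a e)) z - da.ker (crossing_disc (b e)) z)"
  proof (rule M.restricted_multiplier_close_points[OF V \<phi> ker_mem_closed_span[OF V]])
    fix e assume e: "e \<in> I"
    have "a e - b e = of_real (2 - 14 * e)" by (simp add: a_def b_def)
    then have "1 \<le> cmod (a e - b e)" using e by (simp only: norm_of_real) (auto simp: I_def)
    then show "1 \<le> cmod (?\<phi> (crossing_disc (a e)) - ?\<phi> (crossing_disc (b e)))"
      using ab[OF e] by (simp add: phi)
    show "cmod (?\<phi> (crossing_disc (b e))) \<le> 1" using ab[OF e] by (simp add: phi)
  qed (use ab in auto)
  then obtain C where C: "\<And>e. e \<in> I \<Longrightarrow> da.nrm (da.ker (crossing_disc (a e)))
      \<le> C * da.nrm (\<lambda>z. da.ker (crossing_disc (a e)) z - da.ker (crossing_disc (b e)) z)" by blast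
  define R where "R = (\<lambda>e. (k (1 - 5 * e) (1 - 5 * e) - 2 * k (1 - 5 * e) (- (1 - 9 * e))
      + k (- (1 - 9 * e)) (- (1 - 9 * e))) / k (1 - 5 * e) (1 - 5 * e))"
  have R: "(R \<longlongrightarrow> 0) (at_right 0)"
    unfolding R_def k_def by (rule kernel_ratio_tendsto)
  have main: "1 \<le> C\<^sup>2 * R e" if e: "e \<in> I" for e
  proof -
    let ?A = "crossing_disc (a e)" and ?B = "crossing_disc (b e)"
    have AB: "?A \<in> unit_ball" "?B \<in> unit_ball"
      using norm_crossing_disc_lt_1 ab[OF e] by auto
    note mem = da.kernel_mem[OF AB(1)] da.kernel_mem[OF AB(2)]
    have nA: "(da.nrm (da.ker ?A))\<^sup>2 = k (1 - 5 * e) (1 - 5 * e)"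
      unfolding da.nrm_ker_sq[OF AB(1)] unfolding a_def da_kernel_crossing_disc_real k_def by (rule Re_complex_of_real)
    have nB: "(da.nrm (da.ker ?B))\<^sup>2 = k (- (1 - 9 * e)) (- (1 - 9 * e))"
      unfolding da.nrm_ker_sq[OF AB(2)] unfolding b_def da_kernel_crossing_disc_real k_def by (rule Re_complex_of_real)
    have nAB: "Re (da_ip (da.ker ?A) (da.ker ?B)) = k (1 - 5 * e) (- (1 - 9 * e))"
      unfolding da.ip_ker_ker[OF AB] unfolding a_def b_def da_kernel_crossing_disc_real k_def
      by (simp only: Re_complex_of_real mult.commute)
    have diff: "(da.nrm (\<lambda>z. da.ker ?A z - da.ker ?B z))\<^sup>2
        = k (1 - 5 * e) (1 - 5 * e) - 2 * k (1 - 5 * e) (- (1 - 9 * e)) + k (- (1 - 9 * e)) (- (1 - 9 * e))"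
      unfolding da.nrm_sq_diff[OF mem] nA nB nAB by simp
    have "(da.nrm (da.ker ?A))\<^sup>2 = 1 / (1 - (norm ?A)\<^sup>2)"
      by (rule da_nrm_ker_sq[OF AB(1)])
    then have pos: "(da.nrm (da.ker ?A))\<^sup>2 > 0"
      using AB(1) by (simp add: power_less_one_iff)
    have "(da.nrm (da.ker ?A))\<^sup>2 \<le> (C * da.nrm (\<lambda>z. da.ker ?A z - da.ker ?B z))\<^sup>2"
      using C[OF e] da.nrm_nonneg[OF mem(1)] by (rule power_mono)
    then show ?thesis
      using pos unfolding power_mult_distrib diff nA R_def by (simp add: pos_le_divide_eq)
  qed
  have "((\<lambda>e. C\<^sup>2 * R e) \<longlongrightarrow> C\<^sup>2 * 0) (at_right 0)"
    by (intro tendsto_intros R)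
  then have "\<forall>\<^sub>F e in at_right 0. C\<^sup>2 * R e < 1"
    by (rule order_tendstoD) simp
  moreover have "\<forall>\<^sub>F e in at_right 0. e \<in> I"
    unfolding I_def by (rule eventually_at_right_real) simp
  ultimately have "\<forall>\<^sub>F e in at_right (0::real). False"
    by eventually_elim (use main in force)
  then show False by simp
qed

theorem theorem5p2:
  "\<exists>f :: complex \<Rightarrow> complex ^ 2.
     rational_poles_off f (cball 0 1) \<and>
     analytic_disc_map f \<and> proper_disc_map f \<and>
     inj_on f unit_disc \<and>
     (\<forall>z \<in> unit_disc \<union> {1, -1}. \<forall>i.
        (\<lambda>w. f w $ i) field_differentiable (at z within unit_disc \<union> {1, -1})) \<and>
     f 1 = f (-1) \<and>
     meets_boundary_transversally f \<and>
     (\<forall>z \<in> cball 0 1. \<forall>w \<in> cball 0 1.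
        f z = f w \<longrightarrow> z = w \<or> (z = 1 \<and> w = -1) \<or> (z = -1 \<and> w = 1)) \<and>
     disc_biholomorphism f (f ` unit_disc) \<and>
     variety (f ` unit_disc) \<and>
     variety_multipliers (f ` unit_disc) \<subset> H_infinity (f ` unit_disc) \<and>
     res (f ` unit_disc) (inv_into unit_disc f) \<notin> variety_multipliers (f ` unit_disc)"
proof (intro exI[of _ crossing_disc] conjI ballI allI impI)
  show "(\<lambda>w. crossing_disc w $ i) field_differentiable (at z within unit_disc \<union> {1, -1})"
    if "z \<in> unit_disc \<union> {1, -1}" for z i
    using that by (intro crossing_disc_differentiable) auto
  show "z = w \<or> (z = 1 \<and> w = -1) \<or> (z = -1 \<and> w = 1)"
    if "z \<in> cball 0 1" "w \<in> cball 0 1" "crossing_disc z = crossing_disc w" for z w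
    using crossing_disc_almost_inj that by auto
  show "variety_multipliers (crossing_disc ` unit_disc) \<subset> H_infinity (crossing_disc ` unit_disc)"
    using variety_multipliers_subset inverse_in_H_infinity inverse_not_multiplier by blast
qed (fact crossing_disc_rational crossing_disc_analytic crossing_disc_proper crossing_disc_inj
  crossing_disc_crosses crossing_disc_transversal crossing_disc_biholomorphism crossing_disc_variety
  inverse_not_multiplier)+

end
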